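(* Let $G$ be a group. Then $\mathcal{FR}_{R_s}(G)$ is an inverse monoid isomorphic to each of $\mathcal{FI}_{R_s}(G)$ and $\widetilde{G}^{\mathcal R}$.
   Context: Restriction monoids. A restriction semigroup is an algebra $(T;\cdot,{}^*,{}^+)$ with $(T;\cdot)$ a semigroup satisfying $x^+x=x$, $x^+y^+=y^+x^+$, $(x^+y)^+=x^+y^+$, $xy^+=(xy)^+x$; $xx^*=x$, $x^*y^*=y^*x^*$, $(xy^* )^*=x^*y^*$, $x^*y=y(xy)^*$; $(x^+)^*=x^+$, $(x^* )^+=x^*$. A restriction monoid is a restriction semigroup with an identity element, in signature $(\cdot,{}^*,{}^+,1)$; morphisms preserve all operations. Every inverse monoid is a restriction monoid with $a^*=a^{-1}a$, $a^+=aa^{-1}$. $\mathcal{FR}_{R_s}(G)$, the free restriction monoid over $G$ with respect to strong premorphisms, is the restriction monoid generated by the set $\{\lfloor g\rfloor:g\in G\}$ subject to the relations $\lfloor1\rfloor=1$, $\lfloor g\rfloor\lfloor h\rfloor=\lfloor g\rfloor^+\lfloor gh\rfloor$, $\lfloor g\rfloor\lfloor h\rfloor=\lfloor gh\rfloor\lfloor h\rfloor^*$ ($g,h\in G$). $\mathcal{FI}_{R_s}(G)$, the free inverse monoid over $G$ with respect to strong premorphisms, is the inverse monoid generated by the set $\{[g]:g\in G\}$ subject to the relations $[1]=1$, $[g][h]=[g]^+[gh]$, $[g][h]=[gh][h]^*$ ($g,h\in G$). $\widetilde{G}^{\mathcal R}$ is the Birget–Rhodes prefix expansion of $G$; in Szendrei's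 model it is the inverse monoid of all pairs $(A,g)$ with $g\in G$ and $A\subseteq G$ finite containing $1$ and $g$, with multiplication $(A,g)(B,h)=(A\cup gB,gh)$ and inverse $(A,g)^{-1}=(g^{-1}A,g^{-1})$. *)

theory Defs
  imports "HOL-Algebra.Group" "HOL-Algebra.Coset"
begin

section \<open>Restriction monoids\<close>

text \<open>\<open>rstar T x\<close> and \<open>rplus T x\<close> stand for \<open>x\<^sup>*\<close> and \<open>x\<^sup>+\<close>.\<close>

record 'a rmonoid = "'a monoid" +
  rstar :: "'a \<Rightarrow> 'a"
  rplus :: "'a \<Rightarrow> 'a"

locale restriction_monoid = monoid T for T (structure) +
  assumes star_closed: "x \<in> carrier T \<Longrightarrow> rstar T x \<in> carrier T"
    and plus_closed: "x \<in> carrier T \<Longrightarrow> rplus T x \<in> carrier T"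
    and plus_left: "x \<in> carrier T \<Longrightarrow> rplus T x \<otimes> x = x"
    and plus_comm: "\<lbrakk>x \<in> carrier T; y \<in> carrier T\<rbrakk> \<Longrightarrow>
      rplus T x \<otimes> rplus T y = rplus T y \<otimes> rplus T x"
    and plus_plus: "\<lbrakk>x \<in> carrier T; y \<in> carrier T\<rbrakk> \<Longrightarrow>
      rplus T (rplus T x \<otimes> y) = rplus T x \<otimes> rplus T y"
    and plus_ample: "\<lbrakk>x \<in> carrier T; y \<in> carrier T\<rbrakk> \<Longrightarrow>
      x \<otimes> rplus T y = rplus T (x \<otimes> y) \<otimes> x"
    and star_right: "x \<in> carrier T \<Longrightarrow> x \<otimes> rstar T x = x"
    and star_comm: "\<lbrakk>x \<in> carrier T; y \<in> carrier T\<rbrakk> \<Longrightarrow>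
      rstar T x \<otimes> rstar T y = rstar T y \<otimes> rstar T x"
    and star_star: "\<lbrakk>x \<in> carrier T; y \<in> carrier T\<rbrakk> \<Longrightarrow>
      rstar T (x \<otimes> rstar T y) = rstar T x \<otimes> rstar T y"
    and star_ample: "\<lbrakk>x \<in> carrier T; y \<in> carrier T\<rbrakk> \<Longrightarrow>
      rstar T x \<otimes> y = y \<otimes> rstar T (x \<otimes> y)"
    and star_of_plus: "x \<in> carrier T \<Longrightarrow> rstar T (rplus T x) = rplus T x"
    and plus_of_star: "x \<in> carrier T \<Longrightarrow> rplus T (rstar T x) = rstar T x"

definition rm_hom :: "('a, 'm) rmonoid_scheme \<Rightarrow> ('b, 'n) rmonoid_scheme \<Rightarrow> ('a \<Rightarrow> 'b) set" where
  "rm_hom S T = {\<phi> \<in> hom S T. \<phi> \<one>\<^bsub>S\<^esub> = \<one>\<^bsub>T\<^esub> \<and>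
     (\<forall>x \<in> carrier S. \<phi> (rstar S x) = rstar T (\<phi> x) \<and> \<phi> (rplus S x) = rplus T (\<phi> x))}"

definition rm_isomorphic :: "('a, 'm) rmonoid_scheme \<Rightarrow> ('b, 'n) rmonoid_scheme \<Rightarrow> bool" where
  "rm_isomorphic S T \<longleftrightarrow> (\<exists>\<phi> \<in> rm_hom S T. bij_betw \<phi> (carrier S) (carrier T))"

section \<open>Inverse monoids\<close>

locale inverse_monoid = monoid M for M (structure) +
  assumes unique_inverse:
    "x \<in> carrier M \<Longrightarrow> \<exists>!y. y \<in> carrier M \<and> x \<otimes> y \<otimes> x = x \<and> y \<otimes> x \<otimes> y = y"

text \<open>The inverse in the sense of inverse semigroups; the library's \<open>m_inv\<close> is only
  meaningful for units.\<close>

definition im_inv :: "('a, 'm) monoid_scheme \<Rightarrow> 'a \<Rightarrow> 'a" where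
  "im_inv M x = (THE y. y \<in> carrier M \<and> x \<otimes>\<^bsub>M\<^esub> y \<otimes>\<^bsub>M\<^esub> x = x \<and> y \<otimes>\<^bsub>M\<^esub> x \<otimes>\<^bsub>M\<^esub> y = y)"

text \<open>An inverse monoid regarded as a restriction monoid, with \<open>a\<^sup>* = a\<inverse>a\<close> and \<open>a\<^sup>+ = aa\<inverse>\<close>.\<close>

definition rm_of_im :: "('a, 'm) monoid_scheme \<Rightarrow> 'a rmonoid" where
  "rm_of_im M = \<lparr>carrier = carrier M, mult = mult M, one = one M,
     rstar = (\<lambda>a. im_inv M a \<otimes>\<^bsub>M\<^esub> a), rplus = (\<lambda>a. a \<otimes>\<^bsub>M\<^esub> im_inv M a)\<rparr>"

lemma (in inverse_monoid) im_inv_eqI: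
  assumes "x \<in> carrier M" "y \<in> carrier M" "x \<otimes> y \<otimes> x = x" "y \<otimes> x \<otimes> y = y"
  shows "im_inv M x = y"
  unfolding im_inv_def using assms unique_inverse[OF assms(1)] by (intro the1_equality) auto

text \<open>The equational description of inverse monoids in the signature with an inverse operation
  \<open>i\<close>; it underlies the presentations of inverse monoids below.\<close>

lemma inverse_monoid_if_laws:
  fixes M (structure)
  assumes "monoid M"
    and closed: "\<And>x. x \<in> carrier M \<Longrightarrow> i x \<in> carrier M"
    and reg: "\<And>x. x \<in> carrier M \<Longrightarrow> x \<otimes> i x \<otimes> x = x"
    and inv_inv: "\<And>x. x \<in> carrier M \<Longrightarrow> i (i x) = x"
    and inv_mult: "\<And>x y. \<lbrakk>x \<in> carrier M; y \<in> carrier M\<rbrakk> \<Longrightarrow> i (x \<otimes> y) = i y \<otimes> i x"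
    and comm: "\<And>x y. \<lbrakk>x \<in> carrier M; y \<in> carrier M\<rbrakk> \<Longrightarrow>
      (x \<otimes> i x) \<otimes> (y \<otimes> i y) = (y \<otimes> i y) \<otimes> (x \<otimes> i x)"
  shows "inverse_monoid M"
proof -
  interpret monoid M by fact
  have reg': "i x \<otimes> x \<otimes> i x = i x" if "x \<in> carrier M" for x
    using reg[of "i x"] closed[OF that] inv_inv[OF that] by simp
  have idem: "e \<otimes> i e = e" if e: "e \<in> carrier M" "e \<otimes> e = e" for e
  proof -
    note c = e(1) closed[OF e(1)]
    have "i e = i e \<otimes> (e \<otimes> e) \<otimes> i e" using reg' e by simp
    also have "\<dots> = (i e \<otimes> i (i e)) \<otimes> (e \<otimes> i e)" using c inv_inv by (simp add: m_assoc)
    also have "\<dots> = (e \<otimes> i e) \<otimes> (i e \<otimes> i (i e))" using c by (intro comm) auto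
    also have "\<dots> = e \<otimes> (i e \<otimes> i e \<otimes> e)" using c inv_inv by (simp add: m_assoc)
    finally have 1: "i e = e \<otimes> (i e \<otimes> i e \<otimes> e)" .
    have "e \<otimes> i e = e \<otimes> (e \<otimes> (i e \<otimes> i e \<otimes> e))" using 1 by simp
    also have "\<dots> = (e \<otimes> e) \<otimes> (i e \<otimes> i e \<otimes> e)" using c by (simp add: m_assoc)
    also have "\<dots> = i e" using 1 e by simp
    finally have 2: "e \<otimes> i e = i e" .
    have "i (e \<otimes> i e) = e \<otimes> i e" using inv_mult[of e "i e"] c inv_inv by simp
    with 2 have "e = i e" using inv_inv[of e] c by simp
    with 2 show ?thesis by simp
  qed
  have idem_comm: "e \<otimes> f = f \<otimes> e"
    if "e \<in> carrier M" "e \<otimes> e = e" "f \<in> carrier M" "f \<otimes> f = f" for e f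
    using comm[of e f] idem[of e] idem[of f] that by simp
  show ?thesis
  proof
    fix x assume x: "x \<in> carrier M"
    show "\<exists>!y. y \<in> carrier M \<and> x \<otimes> y \<otimes> x = x \<and> y \<otimes> x \<otimes> y = y"
    proof (rule ex_ex1I)
      show "\<exists>y. y \<in> carrier M \<and> x \<otimes> y \<otimes> x = x \<and> y \<otimes> x \<otimes> y = y"
        using x closed reg reg' by blast
    next
      fix y z
      assume "y \<in> carrier M \<and> x \<otimes> y \<otimes> x = x \<and> y \<otimes> x \<otimes> y = y"
        and "z \<in> carrier M \<and> x \<otimes> z \<otimes> x = x \<and> z \<otimes> x \<otimes> z = z"
      then have y: "y \<in> carrier M" "x \<otimes> y \<otimes> x = x" "y \<otimes> x \<otimes> y = y"
        and z: "z \<in> carrier M" "x \<otimes> z \<otimes> x = x" "z \<otimes> x \<otimes> z = z" by auto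
      have id: "(x \<otimes> u) \<otimes> (x \<otimes> u) = x \<otimes> u" "(u \<otimes> x) \<otimes> (u \<otimes> x) = u \<otimes> x"
        if "u \<in> carrier M" "x \<otimes> u \<otimes> x = x" for u
        using that x by (metis m_assoc m_closed)+
      have "y = y \<otimes> (x \<otimes> z \<otimes> x) \<otimes> y" using y z by simp
      also have "\<dots> = y \<otimes> ((x \<otimes> z) \<otimes> (x \<otimes> y))" using x y(1) z(1) by (simp add: m_assoc)
      also have "\<dots> = y \<otimes> ((x \<otimes> y) \<otimes> (x \<otimes> z))" using idem_comm x y z id by simp
      also have "\<dots> = (y \<otimes> x \<otimes> y) \<otimes> (x \<otimes> z)" using x y(1) z(1) by (simp add: m_assoc)
      also have "\<dots> = y \<otimes> x \<otimes> z" using x y z by (simp add: m_assoc)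
      finally have 1: "y = y \<otimes> x \<otimes> z" .
      have "z = z \<otimes> (x \<otimes> y \<otimes> x) \<otimes> z" using y z by simp
      also have "\<dots> = ((z \<otimes> x) \<otimes> (y \<otimes> x)) \<otimes> z" using x y(1) z(1) by (simp add: m_assoc)
      also have "\<dots> = ((y \<otimes> x) \<otimes> (z \<otimes> x)) \<otimes> z" using idem_comm x y z id by simp
      also have "\<dots> = (y \<otimes> x) \<otimes> (z \<otimes> x \<otimes> z)" using x y(1) z(1) by (simp add: m_assoc)
      also have "\<dots> = y \<otimes> x \<otimes> z" using z(3) by simp
      finally show "y = z" using 1 by simp
    qed
  qed
qed

section \<open>Presentations of restriction monoids\<close>

datatype 'x rterm =
  RGen 'x | ROne | RMul "'x rterm" "'x rterm" | RStar "'x rterm" | RPlus "'x rterm"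

definition rterms :: "'x set \<Rightarrow> 'x rterm set" where
  "rterms X = {t. set_rterm t \<subseteq> X}"

text \<open>The least congruence on the algebra of terms over \<open>X\<close> which contains the relations \<open>R\<close> and
  all instances of the restriction monoid identities.\<close>

inductive rt_cong :: "'x set \<Rightarrow> ('x rterm \<times> 'x rterm) set \<Rightarrow> 'x rterm \<Rightarrow> 'x rterm \<Rightarrow> bool"
  for X R where
  rel: "\<lbrakk>(s, t) \<in> R; s \<in> rterms X; t \<in> rterms X\<rbrakk> \<Longrightarrow> rt_cong X R s t"
| refl: "s \<in> rterms X \<Longrightarrow> rt_cong X R s s"
| sym: "rt_cong X R s t \<Longrightarrow> rt_cong X R t s"
| trans: "\<lbrakk>rt_cong X R s t; rt_cong X R t u\<rbrakk> \<Longrightarrow> rt_cong X R s u"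
| mul: "\<lbrakk>rt_cong X R s s'; rt_cong X R t t'\<rbrakk> \<Longrightarrow> rt_cong X R (RMul s t) (RMul s' t')"
| star: "rt_cong X R s t \<Longrightarrow> rt_cong X R (RStar s) (RStar t)"
| plus: "rt_cong X R s t \<Longrightarrow> rt_cong X R (RPlus s) (RPlus t)"
| assoc: "\<lbrakk>s \<in> rterms X; t \<in> rterms X; u \<in> rterms X\<rbrakk> \<Longrightarrow>
    rt_cong X R (RMul (RMul s t) u) (RMul s (RMul t u))"
| one_left: "s \<in> rterms X \<Longrightarrow> rt_cong X R (RMul ROne s) s"
| one_right: "s \<in> rterms X \<Longrightarrow> rt_cong X R (RMul s ROne) s"
| plus_left: "s \<in> rterms X \<Longrightarrow> rt_cong X R (RMul (RPlus s) s) s"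
| plus_comm: "\<lbrakk>s \<in> rterms X; t \<in> rterms X\<rbrakk> \<Longrightarrow>
    rt_cong X R (RMul (RPlus s) (RPlus t)) (RMul (RPlus t) (RPlus s))"
| plus_plus: "\<lbrakk>s \<in> rterms X; t \<in> rterms X\<rbrakk> \<Longrightarrow>
    rt_cong X R (RPlus (RMul (RPlus s) t)) (RMul (RPlus s) (RPlus t))"
| plus_ample: "\<lbrakk>s \<in> rterms X; t \<in> rterms X\<rbrakk> \<Longrightarrow>
    rt_cong X R (RMul s (RPlus t)) (RMul (RPlus (RMul s t)) s)"
| star_right: "s \<in> rterms X \<Longrightarrow> rt_cong X R (RMul s (RStar s)) s"
| star_comm: "\<lbrakk>s \<in> rterms X; t \<in> rterms X\<rbrakk> \<Longrightarrow>
    rt_cong X R (RMul (RStar s) (RStar t)) (RMul (RStar t) (RStar s))"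
| star_star: "\<lbrakk>s \<in> rterms X; t \<in> rterms X\<rbrakk> \<Longrightarrow>
    rt_cong X R (RStar (RMul s (RStar t))) (RMul (RStar s) (RStar t))"
| star_ample: "\<lbrakk>s \<in> rterms X; t \<in> rterms X\<rbrakk> \<Longrightarrow>
    rt_cong X R (RMul (RStar s) t) (RMul t (RStar (RMul s t)))"
| star_of_plus: "s \<in> rterms X \<Longrightarrow> rt_cong X R (RStar (RPlus s)) (RPlus s)"
| plus_of_star: "s \<in> rterms X \<Longrightarrow> rt_cong X R (RPlus (RStar s)) (RStar s)"

definition rt_cong_rel :: "'x set \<Rightarrow> ('x rterm \<times> 'x rterm) set \<Rightarrow> ('x rterm \<times> 'x rterm) set" where
  "rt_cong_rel X R = {(s, t). rt_cong X R s t}"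

definition presented_rm :: "'x set \<Rightarrow> ('x rterm \<times> 'x rterm) set \<Rightarrow> 'x rterm set rmonoid" where
  "presented_rm X R = \<lparr>
     carrier = rterms X // rt_cong_rel X R,
     mult = (\<lambda>A B. \<Union>s\<in>A. \<Union>t\<in>B. rt_cong_rel X R `` {RMul s t}),
     one = rt_cong_rel X R `` {ROne},
     rstar = (\<lambda>A. \<Union>s\<in>A. rt_cong_rel X R `` {RStar s}),
     rplus = (\<lambda>A. \<Union>s\<in>A. rt_cong_rel X R `` {RPlus s})\<rparr>"

lemma rterms_simps [simp]:
  "RGen x \<in> rterms X \<longleftrightarrow> x \<in> X"
  "ROne \<in> rterms X"
  "RMul s t \<in> rterms X \<longleftrightarrow> s \<in> rterms X \<and> t \<in> rterms X"
  "RStar s \<in> rterms X \<longleftrightarrow> s \<in> rterms X"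
  "RPlus s \<in> rterms X \<longleftrightarrow> s \<in> rterms X"
  by (auto simp: rterms_def)

lemma rt_cong_rterms: "rt_cong X R s t \<Longrightarrow> s \<in> rterms X \<and> t \<in> rterms X"
  by (induction rule: rt_cong.induct) auto

lemma equiv_rt_cong_rel: "equiv (rterms X) (rt_cong_rel X R)"
  by (rule equivI)
    (auto simp: rt_cong_rel_def refl_on_def sym_def trans_def dest: rt_cong_rterms
      intro: rt_cong.refl rt_cong.sym rt_cong.trans)

lemma rt_cong_class_eq_iff:
  "\<lbrakk>s \<in> rterms X; t \<in> rterms X\<rbrakk> \<Longrightarrow>
    rt_cong_rel X R `` {s} = rt_cong_rel X R `` {t} \<longleftrightarrow> rt_cong X R s t"
  by (subst eq_equiv_class_iff[OF equiv_rt_cong_rel]) (simp_all add: rt_cong_rel_def)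

lemma presented_rm_simps:
  "carrier (presented_rm X R) = rterms X // rt_cong_rel X R"
  "\<one>\<^bsub>presented_rm X R\<^esub> = rt_cong_rel X R `` {ROne}"
  "\<lbrakk>s \<in> rterms X; t \<in> rterms X\<rbrakk> \<Longrightarrow>
    rt_cong_rel X R `` {s} \<otimes>\<^bsub>presented_rm X R\<^esub> rt_cong_rel X R `` {t} = rt_cong_rel X R `` {RMul s t}"
  "s \<in> rterms X \<Longrightarrow> rstar (presented_rm X R) (rt_cong_rel X R `` {s}) = rt_cong_rel X R `` {RStar s}"
  "s \<in> rterms X \<Longrightarrow> rplus (presented_rm X R) (rt_cong_rel X R `` {s}) = rt_cong_rel X R `` {RPlus s}"
proof -
  note E = equiv_rt_cong_rel[of X R]
  have 2: "congruent2 (rt_cong_rel X R) (rt_cong_rel X R) (\<lambda>s t. rt_cong_rel X R `` {RMul s t})"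
    by (rule congruent2I')
      (rule equiv_class_eq[OF E], auto simp: rt_cong_rel_def intro: rt_cong.mul)
  have s: "congruent (rt_cong_rel X R) (\<lambda>s. rt_cong_rel X R `` {RStar s})"
    by (rule congruentI)
      (rule equiv_class_eq[OF E], auto simp: rt_cong_rel_def intro: rt_cong.star)
  have p: "congruent (rt_cong_rel X R) (\<lambda>s. rt_cong_rel X R `` {RPlus s})"
    by (rule congruentI)
      (rule equiv_class_eq[OF E], auto simp: rt_cong_rel_def intro: rt_cong.plus)
  show "carrier (presented_rm X R) = rterms X // rt_cong_rel X R"
    "\<one>\<^bsub>presented_rm X R\<^esub> = rt_cong_rel X R `` {ROne}"
    by (simp_all add: presented_rm_def)
  show "\<lbrakk>s \<in> rterms X; t \<in> rterms X\<rbrakk> \<Longrightarrow>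
    rt_cong_rel X R `` {s} \<otimes>\<^bsub>presented_rm X R\<^esub> rt_cong_rel X R `` {t} = rt_cong_rel X R `` {RMul s t}"
    by (simp add: presented_rm_def UN_equiv_class2[OF E E 2])
  show "s \<in> rterms X \<Longrightarrow> rstar (presented_rm X R) (rt_cong_rel X R `` {s}) = rt_cong_rel X R `` {RStar s}"
    by (simp add: presented_rm_def UN_equiv_class[OF E s])
  show "s \<in> rterms X \<Longrightarrow> rplus (presented_rm X R) (rt_cong_rel X R `` {s}) = rt_cong_rel X R `` {RPlus s}"
    by (simp add: presented_rm_def UN_equiv_class[OF E p])
qed

lemma restriction_monoid_presented_rm: "restriction_monoid (presented_rm X R)"
  by unfold_locales
    (auto simp: presented_rm_simps quotientI rt_cong_class_eq_iff elim!: quotientE del: equalityI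
      intro!: rt_cong.assoc rt_cong.one_left rt_cong.one_right
        rt_cong.plus_left rt_cong.plus_comm rt_cong.plus_plus rt_cong.plus_ample
        rt_cong.star_right rt_cong.star_comm rt_cong.star_star rt_cong.star_ample
        rt_cong.star_of_plus rt_cong.plus_of_star)

section \<open>Presentations of inverse monoids\<close>

datatype 'x iterm = IGen 'x | IOne | IMul "'x iterm" "'x iterm" | IInv "'x iterm"

definition iterms :: "'x set \<Rightarrow> 'x iterm set" where
  "iterms X = {t. set_iterm t \<subseteq> X}"

text \<open>The least congruence on the algebra of terms over \<open>X\<close> which contains the relations \<open>R\<close> and
  all instances of the identities defining the variety of inverse monoids.\<close>

inductive it_cong :: "'x set \<Rightarrow> ('x iterm \<times> 'x iterm) set \<Rightarrow> 'x iterm \<Rightarrow> 'x iterm \<Rightarrow> bool"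
  for X R where
  rel: "\<lbrakk>(s, t) \<in> R; s \<in> iterms X; t \<in> iterms X\<rbrakk> \<Longrightarrow> it_cong X R s t"
| refl: "s \<in> iterms X \<Longrightarrow> it_cong X R s s"
| sym: "it_cong X R s t \<Longrightarrow> it_cong X R t s"
| trans: "\<lbrakk>it_cong X R s t; it_cong X R t u\<rbrakk> \<Longrightarrow> it_cong X R s u"
| mul: "\<lbrakk>it_cong X R s s'; it_cong X R t t'\<rbrakk> \<Longrightarrow> it_cong X R (IMul s t) (IMul s' t')"
| inv: "it_cong X R s t \<Longrightarrow> it_cong X R (IInv s) (IInv t)"
| assoc: "\<lbrakk>s \<in> iterms X; t \<in> iterms X; u \<in> iterms X\<rbrakk> \<Longrightarrow>
    it_cong X R (IMul (IMul s t) u) (IMul s (IMul t u))"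
| one_left: "s \<in> iterms X \<Longrightarrow> it_cong X R (IMul IOne s) s"
| one_right: "s \<in> iterms X \<Longrightarrow> it_cong X R (IMul s IOne) s"
| regular: "s \<in> iterms X \<Longrightarrow> it_cong X R (IMul (IMul s (IInv s)) s) s"
| inv_inv: "s \<in> iterms X \<Longrightarrow> it_cong X R (IInv (IInv s)) s"
| inv_mul: "\<lbrakk>s \<in> iterms X; t \<in> iterms X\<rbrakk> \<Longrightarrow>
    it_cong X R (IInv (IMul s t)) (IMul (IInv t) (IInv s))"
| comm: "\<lbrakk>s \<in> iterms X; t \<in> iterms X\<rbrakk> \<Longrightarrow>
    it_cong X R (IMul (IMul s (IInv s)) (IMul t (IInv t))) (IMul (IMul t (IInv t)) (IMul s (IInv s)))"

definition it_cong_rel :: "'x set \<Rightarrow> ('x iterm \<times> 'x iterm) set \<Rightarrow> ('x iterm \<times> 'x iterm) set" where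
  "it_cong_rel X R = {(s, t). it_cong X R s t}"

text \<open>The inverse operation is not part of the record: it is recovered as \<open>im_inv\<close>, see
  \<open>im_inv_presented_im\<close> below.\<close>

definition presented_im :: "'x set \<Rightarrow> ('x iterm \<times> 'x iterm) set \<Rightarrow> 'x iterm set monoid" where
  "presented_im X R = \<lparr>
     carrier = iterms X // it_cong_rel X R,
     mult = (\<lambda>A B. \<Union>s\<in>A. \<Union>t\<in>B. it_cong_rel X R `` {IMul s t}),
     one = it_cong_rel X R `` {IOne}\<rparr>"

lemma iterms_simps [simp]:
  "IGen x \<in> iterms X \<longleftrightarrow> x \<in> X"
  "IOne \<in> iterms X"
  "IMul s t \<in> iterms X \<longleftrightarrow> s \<in> iterms X \<and> t \<in> iterms X"
  "IInv s \<in> iterms X \<longleftrightarrow> s \<in> iterms X"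
  by (auto simp: iterms_def)

lemma it_cong_iterms: "it_cong X R s t \<Longrightarrow> s \<in> iterms X \<and> t \<in> iterms X"
  by (induction rule: it_cong.induct) auto

lemma equiv_it_cong_rel: "equiv (iterms X) (it_cong_rel X R)"
  by (rule equivI)
    (auto simp: it_cong_rel_def refl_on_def sym_def trans_def dest: it_cong_iterms
      intro: it_cong.refl it_cong.sym it_cong.trans)

lemma it_cong_class_eq_iff:
  "\<lbrakk>s \<in> iterms X; t \<in> iterms X\<rbrakk> \<Longrightarrow>
    it_cong_rel X R `` {s} = it_cong_rel X R `` {t} \<longleftrightarrow> it_cong X R s t"
  by (subst eq_equiv_class_iff[OF equiv_it_cong_rel]) (simp_all add: it_cong_rel_def)

lemma presented_im_simps:
  "carrier (presented_im X R) = iterms X // it_cong_rel X R"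
  "\<one>\<^bsub>presented_im X R\<^esub> = it_cong_rel X R `` {IOne}"
  "\<lbrakk>s \<in> iterms X; t \<in> iterms X\<rbrakk> \<Longrightarrow>
    it_cong_rel X R `` {s} \<otimes>\<^bsub>presented_im X R\<^esub> it_cong_rel X R `` {t} = it_cong_rel X R `` {IMul s t}"
proof -
  note E = equiv_it_cong_rel[of X R]
  have 2: "congruent2 (it_cong_rel X R) (it_cong_rel X R) (\<lambda>s t. it_cong_rel X R `` {IMul s t})"
    by (rule congruent2I')
      (rule equiv_class_eq[OF E], auto simp: it_cong_rel_def intro: it_cong.mul)
  show "carrier (presented_im X R) = iterms X // it_cong_rel X R"
    "\<one>\<^bsub>presented_im X R\<^esub> = it_cong_rel X R `` {IOne}"
    by (simp_all add: presented_im_def)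
  show "\<lbrakk>s \<in> iterms X; t \<in> iterms X\<rbrakk> \<Longrightarrow>
    it_cong_rel X R `` {s} \<otimes>\<^bsub>presented_im X R\<^esub> it_cong_rel X R `` {t} = it_cong_rel X R `` {IMul s t}"
    by (simp add: presented_im_def UN_equiv_class2[OF E E 2])
qed

lemma inverse_monoid_presented_im: "inverse_monoid (presented_im X R)"
proof (rule inverse_monoid_if_laws)
  define i where "i = (\<lambda>A. \<Union>s\<in>A. it_cong_rel X R `` {IInv s})"
  note E = equiv_it_cong_rel[of X R]
  have c: "congruent (it_cong_rel X R) (\<lambda>s. it_cong_rel X R `` {IInv s})"
    by (rule congruentI)
      (rule equiv_class_eq[OF E], auto simp: it_cong_rel_def intro: it_cong.inv)
  have i: "i (it_cong_rel X R `` {s}) = it_cong_rel X R `` {IInv s}" if "s \<in> iterms X" for s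
    using that by (simp add: i_def UN_equiv_class[OF E c])
  note * = presented_im_simps quotientI i it_cong_class_eq_iff
  show "monoid (presented_im X R)"
    by unfold_locales
      (auto simp: * elim!: quotientE del: equalityI
        intro!: it_cong.assoc it_cong.one_left it_cong.one_right)
  show "\<And>x. x \<in> carrier (presented_im X R) \<Longrightarrow> i x \<in> carrier (presented_im X R)"
    by (auto simp: * elim!: quotientE del: equalityI)
  show "\<And>x. x \<in> carrier (presented_im X R) \<Longrightarrow>
      x \<otimes>\<^bsub>presented_im X R\<^esub> i x \<otimes>\<^bsub>presented_im X R\<^esub> x = x"
    by (auto simp: * elim!: quotientE del: equalityI intro!: it_cong.regular)
  show "\<And>x. x \<in> carrier (presented_im X R) \<Longrightarrow> i (i x) = x"
    by (auto simp: * elim!: quotientE del: equalityI intro!: it_cong.inv_inv)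
  show "\<And>x y. \<lbrakk>x \<in> carrier (presented_im X R); y \<in> carrier (presented_im X R)\<rbrakk> \<Longrightarrow>
      i (x \<otimes>\<^bsub>presented_im X R\<^esub> y) = i y \<otimes>\<^bsub>presented_im X R\<^esub> i x"
    by (auto simp: * elim!: quotientE del: equalityI intro!: it_cong.inv_mul)
  show "\<And>x y. \<lbrakk>x \<in> carrier (presented_im X R); y \<in> carrier (presented_im X R)\<rbrakk> \<Longrightarrow>
      x \<otimes>\<^bsub>presented_im X R\<^esub> i x \<otimes>\<^bsub>presented_im X R\<^esub> (y \<otimes>\<^bsub>presented_im X R\<^esub> i y) =
      y \<otimes>\<^bsub>presented_im X R\<^esub> i y \<otimes>\<^bsub>presented_im X R\<^esub> (x \<otimes>\<^bsub>presented_im X R\<^esub> i x)"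
    by (auto simp: * elim!: quotientE del: equalityI intro!: it_cong.comm)
qed

lemma im_inv_presented_im:
  assumes s: "s \<in> iterms X"
  shows "im_inv (presented_im X R) (it_cong_rel X R `` {s}) = it_cong_rel X R `` {IInv s}"
proof -
  have 1: "it_cong X R (IMul (IMul (IInv s) s) (IInv s)) (IInv s)"
  proof (rule it_cong.trans)
    show "it_cong X R (IMul (IMul (IInv s) s) (IInv s)) (IMul (IMul (IInv s) (IInv (IInv s))) (IInv s))"
      using s by (intro it_cong.mul it_cong.refl it_cong.sym[OF it_cong.inv_inv]) auto
    show "it_cong X R (IMul (IMul (IInv s) (IInv (IInv s))) (IInv s)) (IInv s)"
      using s by (intro it_cong.regular) auto
  qed
  show ?thesis
    using s
    by (intro inverse_monoid.im_inv_eqI[OF inverse_monoid_presented_im])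
      (auto simp: presented_im_simps quotientI it_cong_class_eq_iff intro!: 1 it_cong.regular)
qed

section \<open>The free restriction and inverse monoids over a group with respect to strong premorphisms\<close>

definition FR_relations :: "('g, 'm) monoid_scheme \<Rightarrow> ('g rterm \<times> 'g rterm) set" where
  "FR_relations G = {(RGen \<one>\<^bsub>G\<^esub>, ROne)}
     \<union> {(RMul (RGen g) (RGen h), RMul (RPlus (RGen g)) (RGen (g \<otimes>\<^bsub>G\<^esub> h))) | g h.
         g \<in> carrier G \<and> h \<in> carrier G}
     \<union> {(RMul (RGen g) (RGen h), RMul (RGen (g \<otimes>\<^bsub>G\<^esub> h)) (RStar (RGen h))) | g h.
         g \<in> carrier G \<and> h \<in> carrier G}"

definition FR :: "('g, 'm) monoid_scheme \<Rightarrow> 'g rterm set rmonoid" where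
  "FR G = presented_rm (carrier G) (FR_relations G)"

abbreviation IPlus :: "'x iterm \<Rightarrow> 'x iterm" where "IPlus s \<equiv> IMul s (IInv s)"
abbreviation IStar :: "'x iterm \<Rightarrow> 'x iterm" where "IStar s \<equiv> IMul (IInv s) s"

definition FI_relations :: "('g, 'm) monoid_scheme \<Rightarrow> ('g iterm \<times> 'g iterm) set" where
  "FI_relations G = {(IGen \<one>\<^bsub>G\<^esub>, IOne)}
     \<union> {(IMul (IGen g) (IGen h), IMul (IPlus (IGen g)) (IGen (g \<otimes>\<^bsub>G\<^esub> h))) | g h.
         g \<in> carrier G \<and> h \<in> carrier G}
     \<union> {(IMul (IGen g) (IGen h), IMul (IGen (g \<otimes>\<^bsub>G\<^esub> h)) (IStar (IGen h))) | g h.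
         g \<in> carrier G \<and> h \<in> carrier G}"

definition FI :: "('g, 'm) monoid_scheme \<Rightarrow> 'g iterm set monoid" where
  "FI G = presented_im (carrier G) (FI_relations G)"

section \<open>The Birget--Rhodes prefix expansion in Szendrei's model\<close>

definition prefix_expansion :: "('g, 'm) monoid_scheme \<Rightarrow> ('g set \<times> 'g) monoid" where
  "prefix_expansion G = \<lparr>
     carrier = {(A, g). g \<in> carrier G \<and> A \<subseteq> carrier G \<and> finite A \<and> \<one>\<^bsub>G\<^esub> \<in> A \<and> g \<in> A},
     mult = (\<lambda>(A, g) (B, h). (A \<union> (g <#\<^bsub>G\<^esub> B), g \<otimes>\<^bsub>G\<^esub> h)),
     one = ({\<one>\<^bsub>G\<^esub>}, \<one>\<^bsub>G\<^esub>)\<rparr>"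

text \<open>The inverse of \<open>(A, g)\<close> is \<open>(g\<inverse>A, g\<inverse>)\<close>.\<close>

lemma (in group) prefix_expansion_inverse:
  "inverse_monoid (prefix_expansion G)" (is ?A)
  "(A, g) \<in> carrier (prefix_expansion G) \<Longrightarrow>
    im_inv (prefix_expansion G) (A, g) = (inv g <# A, inv g)" (is "?c \<Longrightarrow> ?B")
proof -
  let ?P = "prefix_expansion G"
  define i where "i = (\<lambda>(A, g). (inv g <# A, inv g))"
  have mult: "(A, g) \<otimes>\<^bsub>?P\<^esub> (B, h) = (A \<union> (g <# B), g \<otimes> h)" for A B g h
    by (simp add: prefix_expansion_def)
  have carr: "(A, g) \<in> carrier ?P \<longleftrightarrow>
      g \<in> carrier G \<and> A \<subseteq> carrier G \<and> finite A \<and> \<one> \<in> A \<and> g \<in> A" for A g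
    by (simp add: prefix_expansion_def)
  have one: "\<one>\<^bsub>?P\<^esub> = ({\<one>}, \<one>)"
    by (simp add: prefix_expansion_def)
  have coset: "g <# B = (\<lambda>b. g \<otimes> b) ` B" for g B
    by (auto simp: l_coset_def)
  have coset_un: "g <# (A \<union> B) = (g <# A) \<union> (g <# B)" for g A B
    by (simp add: coset image_Un)
  have memI: "a \<in> g <# A" if "b \<in> A" "a = g \<otimes> b" for a b g A
    using that by (auto simp: coset)
  have fin: "finite (g <# A)" if "finite A" for g A
    using that by (simp add: coset)
  have icl: "i x \<in> carrier ?P" if "x \<in> carrier ?P" for x
  proof -
    obtain A g where x: "x = (A, g)" by fastforce
    have c: "g \<in> carrier G" "A \<subseteq> carrier G" "finite A" "\<one> \<in> A" "g \<in> A"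
      using that by (auto simp: x carr)
    have "\<one> \<in> inv g <# A" "inv g \<in> inv g <# A"
      using c by (auto intro: memI[of g] memI[of \<one>])
    with c show ?thesis
      by (simp add: x i_def carr fin l_coset_subset_G)
  qed
  have mon: "monoid ?P"
  proof
    fix x y assume "x \<in> carrier ?P" "y \<in> carrier ?P"
    then show "x \<otimes>\<^bsub>?P\<^esub> y \<in> carrier ?P"
      by (cases x; cases y) (auto simp: carr mult fin coset)
  next
    fix x y z assume "x \<in> carrier ?P" "y \<in> carrier ?P" "z \<in> carrier ?P"
    then show "x \<otimes>\<^bsub>?P\<^esub> y \<otimes>\<^bsub>?P\<^esub> z = x \<otimes>\<^bsub>?P\<^esub> (y \<otimes>\<^bsub>?P\<^esub> z)"
      by (cases x; cases y; cases z) (auto simp: carr mult coset_un lcos_m_assoc m_assoc)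
  next
    show "\<one>\<^bsub>?P\<^esub> \<in> carrier ?P" by (simp add: carr one)
  next
    fix x assume x: "x \<in> carrier ?P"
    obtain A g where [simp]: "x = (A, g)" by fastforce
    have c: "g \<in> carrier G" "A \<subseteq> carrier G" "\<one> \<in> A" "g \<in> A"
      using x by (auto simp: carr)
    have "g <# {\<one>} = {g}" using c by (simp add: coset)
    then show "\<one>\<^bsub>?P\<^esub> \<otimes>\<^bsub>?P\<^esub> x = x" "x \<otimes>\<^bsub>?P\<^esub> \<one>\<^bsub>?P\<^esub> = x"
      using c by (simp_all add: one mult lcos_mult_one insert_absorb)
  qed
  have reg: "x \<otimes>\<^bsub>?P\<^esub> i x \<otimes>\<^bsub>?P\<^esub> x = x" if "x \<in> carrier ?P" for x
    using that by (cases x) (auto simp: carr i_def mult lcos_m_assoc lcos_mult_one)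
  have inv_inv: "i (i x) = x" if "x \<in> carrier ?P" for x
    using that by (cases x) (auto simp: carr i_def lcos_m_assoc lcos_mult_one)
  show ?A
  proof (rule inverse_monoid_if_laws[OF mon icl reg inv_inv])
    fix x y assume xy: "x \<in> carrier ?P" "y \<in> carrier ?P"
    obtain A g B h where [simp]: "x = (A, g)" "y = (B, h)" by (metis surj_pair)
    have c: "g \<in> carrier G" "h \<in> carrier G" "A \<subseteq> carrier G" "B \<subseteq> carrier G"
      using xy by (auto simp: carr)
    then show "i (x \<otimes>\<^bsub>?P\<^esub> y) = i y \<otimes>\<^bsub>?P\<^esub> i x"
      by (auto simp: i_def mult coset_un lcos_m_assoc inv_mult_group m_assoc)
    show "x \<otimes>\<^bsub>?P\<^esub> i x \<otimes>\<^bsub>?P\<^esub> (y \<otimes>\<^bsub>?P\<^esub> i y) = y \<otimes>\<^bsub>?P\<^esub> i y \<otimes>\<^bsub>?P\<^esub> (x \<otimes>\<^bsub>?P\<^esub> i x)"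
      using c by (auto simp: i_def mult lcos_m_assoc lcos_mult_one)
  qed auto
  then interpret P: inverse_monoid ?P .
  show "?c \<Longrightarrow> ?B"
    using icl[of "(A, g)"] reg[of "(A, g)"] reg[of "i (A, g)"] inv_inv[of "(A, g)"]
    by (intro P.im_inv_eqI) (auto simp: i_def)
qed

end

theory Submission
  imports Defs "HOL-Algebra.FiniteProduct"
begin

text \<open>Let \<open>f\<close> be a strong premorphism from \<open>G\<close> to a restriction monoid and put \<open>e g = (f g)\<^sup>+\<close>.
  The defining relations give \<open>f g \<cdot> e a = e (ga) \<cdot> f g\<close>, \<open>f g \<cdot> f h = e g \<cdot> f (gh)\<close> and
  \<open>(f g)\<^sup>* = e (g\<inverse>)\<close>, so \<open>(A, g) \<mapsto> (\<Prod>a\<in>A. e a) \<cdot> f g\<close> is a morphism from the prefix expansion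
  which maps \<open>({1, g}, g)\<close> to \<open>f g\<close>. If \<open>f\<close> is the canonical map to the free restriction monoid or
  the free inverse monoid, this morphism is surjective because its image contains the generators,
  and it has a left inverse given by the universal property and the strong premorphism
  \<open>g \<mapsto> ({1, g}, g)\<close>.\<close>

section \<open>Inverse monoids: commuting idempotents and the induced restriction structure\<close>

context inverse_monoid
begin

lemma im_inv_props:
  assumes "x \<in> carrier M"
  shows "im_inv M x \<in> carrier M" "x \<otimes> im_inv M x \<otimes> x = x"
    "im_inv M x \<otimes> x \<otimes> im_inv M x = im_inv M x"
  using theI'[OF unique_inverse[OF assms]] by (simp_all add: im_inv_def)

lemma im_inv_im_inv [simp]: "x \<in> carrier M \<Longrightarrow> im_inv M (im_inv M x) = x"
  by (intro im_inv_eqI im_inv_props)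

lemma im_inv_idem: "\<lbrakk>e \<in> carrier M; e \<otimes> e = e\<rbrakk> \<Longrightarrow> im_inv M e = e"
  by (intro im_inv_eqI) simp_all

lemma idem_mult_idem:
  assumes e: "e \<in> carrier M" "e \<otimes> e = e" and f: "f \<in> carrier M" "f \<otimes> f = f"
  shows "(e \<otimes> f) \<otimes> (e \<otimes> f) = e \<otimes> f"
proof -
  \<comment> \<open>With \<open>x\<close> the inverse of \<open>ef\<close>, the element \<open>fxe\<close> is another inverse, so \<open>x = fxe\<close>, which is idempotent
    and therefore equal to its own inverse \<open>ef\<close>.\<close>
  define x where "x = im_inv M (e \<otimes> f)"
  have x: "x \<in> carrier M" "(e \<otimes> f) \<otimes> x \<otimes> (e \<otimes> f) = e \<otimes> f" "x \<otimes> (e \<otimes> f) \<otimes> x = x"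
    using im_inv_props[of "e \<otimes> f"] e(1) f(1) by (simp_all add: x_def)
  have ee: "e \<otimes> (e \<otimes> z) = e \<otimes> z" if "z \<in> carrier M" for z
    using m_assoc[of e e z] e that by simp
  have ff: "f \<otimes> (f \<otimes> z) = f \<otimes> z" if "z \<in> carrier M" for z
    using m_assoc[of f f z] f that by simp
  note [simp] = e(1) f(1) x(1)
  have x3: "x \<otimes> (e \<otimes> (f \<otimes> (x \<otimes> e))) = x \<otimes> e"
    using arg_cong[OF x(3), of "\<lambda>z. z \<otimes> e"] by (simp add: m_assoc)
  have "im_inv M (e \<otimes> f) = f \<otimes> x \<otimes> e"
    using x(2) by (intro im_inv_eqI) (simp_all add: m_assoc ee ff x3)
  then have fxe: "x = f \<otimes> (x \<otimes> e)"
    by (simp add: x_def[symmetric] m_assoc)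
  have "x \<otimes> x = (f \<otimes> (x \<otimes> e)) \<otimes> (f \<otimes> (x \<otimes> e))"
    using fxe by (rule arg_cong2[of _ _ _ _ "(\<otimes>)"]) (rule fxe)
  also have "\<dots> = f \<otimes> (x \<otimes> (e \<otimes> (f \<otimes> (x \<otimes> e))))"
    by (simp add: m_assoc)
  also have "\<dots> = x"
    unfolding x3 by (rule fxe[symmetric])
  finally have "x \<otimes> x = x" .
  then have "im_inv M x = x" by (intro im_inv_idem) simp_all
  then have "x = e \<otimes> f" by (simp add: x_def)
  with \<open>x \<otimes> x = x\<close> show ?thesis by simp
qed

text \<open>Both \<open>e \<otimes> f\<close> and \<open>f \<otimes> e\<close> are idempotent by
  \<open>idem_mult_idem\<close>. The first is therefore its own inverse, and the second satisfies
  the inverse equations for the first, so uniqueness of inverses identifies them.\<close>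

lemma idem_comm:
  assumes e: "e \<in> carrier M" "e \<otimes> e = e" and f: "f \<in> carrier M" "f \<otimes> f = f"
  shows "e \<otimes> f = f \<otimes> e"
proof -
  have ee: "e \<otimes> (e \<otimes> z) = e \<otimes> z" if "z \<in> carrier M" for z
    using m_assoc[of e e z] e that by simp
  have ff: "f \<otimes> (f \<otimes> z) = f \<otimes> z" if "z \<in> carrier M" for z
    using m_assoc[of f f z] f that by simp
  have "im_inv M (e \<otimes> f) = e \<otimes> f"
    using idem_mult_idem[OF e f] e f by (intro im_inv_idem) simp_all
  moreover have "im_inv M (e \<otimes> f) = f \<otimes> e"
    using idem_mult_idem[OF e f] idem_mult_idem[OF f e] e(1) f(1)
    by (intro im_inv_eqI) (simp_all add: m_assoc ee ff)
  ultimately show ?thesis by simp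
qed

lemma idem_mult_im_inv:
  assumes "x \<in> carrier M"
  shows "(x \<otimes> im_inv M x) \<otimes> (x \<otimes> im_inv M x) = x \<otimes> im_inv M x"
    "(im_inv M x \<otimes> x) \<otimes> (im_inv M x \<otimes> x) = im_inv M x \<otimes> x"
  using im_inv_props[OF assms] assms by (simp_all add: m_assoc[symmetric])

text \<open>In each inverse equation the two idempotents \<open>im_inv M x \<otimes> x\<close> and
  \<open>y \<otimes> im_inv M y\<close> meet in the middle. Swapping them separates the product into
  the corresponding equations for \<open>x\<close> and for \<open>y\<close>.\<close>

lemma im_inv_mult:
  assumes x: "x \<in> carrier M" and y: "y \<in> carrier M"
  shows "im_inv M (x \<otimes> y) = im_inv M y \<otimes> im_inv M x"
proof -
  note c [simp] = x y im_inv_props(1)[OF x] im_inv_props(1)[OF y]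
  have comm: "(im_inv M x \<otimes> x) \<otimes> (y \<otimes> im_inv M y) = (y \<otimes> im_inv M y) \<otimes> (im_inv M x \<otimes> x)"
    by (intro idem_comm idem_mult_im_inv) simp_all
  have "x \<otimes> y \<otimes> (im_inv M y \<otimes> im_inv M x) \<otimes> (x \<otimes> y)
      = x \<otimes> ((y \<otimes> im_inv M y) \<otimes> (im_inv M x \<otimes> x)) \<otimes> y"
    by (simp add: m_assoc)
  also have "\<dots> = (x \<otimes> im_inv M x \<otimes> x) \<otimes> (y \<otimes> im_inv M y \<otimes> y)"
    unfolding comm[symmetric] by (simp add: m_assoc)
  also have "\<dots> = x \<otimes> y"
    by (simp add: im_inv_props)
  finally have 1: "x \<otimes> y \<otimes> (im_inv M y \<otimes> im_inv M x) \<otimes> (x \<otimes> y) = x \<otimes> y" .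
  have "im_inv M y \<otimes> im_inv M x \<otimes> (x \<otimes> y) \<otimes> (im_inv M y \<otimes> im_inv M x)
      = im_inv M y \<otimes> ((im_inv M x \<otimes> x) \<otimes> (y \<otimes> im_inv M y)) \<otimes> im_inv M x"
    by (simp add: m_assoc)
  also have "\<dots> = (im_inv M y \<otimes> y \<otimes> im_inv M y) \<otimes> (im_inv M x \<otimes> x \<otimes> im_inv M x)"
    unfolding comm by (simp add: m_assoc)
  also have "\<dots> = im_inv M y \<otimes> im_inv M x"
    by (simp add: im_inv_props)
  finally show ?thesis using 1 by (intro im_inv_eqI) simp_all
qed

lemma mult_im_inv_comm:
  assumes "x \<in> carrier M" "y \<in> carrier M"
  shows "(x \<otimes> im_inv M x) \<otimes> (y \<otimes> im_inv M y) = (y \<otimes> im_inv M y) \<otimes> (x \<otimes> im_inv M x)"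
  using assms by (intro idem_comm idem_mult_im_inv) (simp_all add: im_inv_props)

lemma im_inv_mult_comm:
  assumes "x \<in> carrier M" "y \<in> carrier M"
  shows "(im_inv M x \<otimes> x) \<otimes> (im_inv M y \<otimes> y) = (im_inv M y \<otimes> y) \<otimes> (im_inv M x \<otimes> x)"
  using assms by (intro idem_comm idem_mult_im_inv) (simp_all add: im_inv_props)

text \<open>Brings the free inverse monoid and the prefix expansion under the theory of restriction
  monoids. The identities come down to the commuting of idempotents and the formula for the inverse
  of a product.\<close>

lemma restriction_monoid_rm_of_im: "restriction_monoid (rm_of_im M)"
proof -
  have comm2: "(im_inv M x \<otimes> x) \<otimes> (y \<otimes> im_inv M y) = (y \<otimes> im_inv M y) \<otimes> (im_inv M x \<otimes> x)"
    if "x \<in> carrier M" "y \<in> carrier M" for x y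
    using that by (intro idem_comm idem_mult_im_inv) (simp_all add: im_inv_props)
  \<comment> \<open>\<open>pp\<close> and \<open>ss\<close> are \<open>plus_plus\<close> and
    \<open>star_star\<close> with an arbitrary idempotent \<open>p\<close> in place of the
    projection; \<open>pa\<close> and \<open>sa\<close> are the two ample identities.\<close>
  have pp: "(p \<otimes> y) \<otimes> im_inv M (p \<otimes> y) = p \<otimes> (y \<otimes> im_inv M y)"
    if "p \<in> carrier M" "p \<otimes> p = p" "y \<in> carrier M" for p y
  proof -
    have "(p \<otimes> y) \<otimes> im_inv M (p \<otimes> y) = p \<otimes> ((y \<otimes> im_inv M y) \<otimes> p)"
      using that by (simp add: im_inv_mult im_inv_idem im_inv_props m_assoc)
    also have "(y \<otimes> im_inv M y) \<otimes> p = p \<otimes> (y \<otimes> im_inv M y)"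
      using that by (intro idem_comm idem_mult_im_inv) (simp_all add: im_inv_props)
    also have "p \<otimes> \<dots> = p \<otimes> (y \<otimes> im_inv M y)"
      using that by (simp add: im_inv_props m_assoc[symmetric])
    finally show ?thesis .
  qed
  have ss: "im_inv M (x \<otimes> p) \<otimes> (x \<otimes> p) = (im_inv M x \<otimes> x) \<otimes> p"
    if "p \<in> carrier M" "p \<otimes> p = p" "x \<in> carrier M" for p x
  proof -
    have "im_inv M (x \<otimes> p) \<otimes> (x \<otimes> p) = (p \<otimes> (im_inv M x \<otimes> x)) \<otimes> p"
      using that by (simp add: im_inv_mult im_inv_idem im_inv_props m_assoc)
    also have "p \<otimes> (im_inv M x \<otimes> x) = (im_inv M x \<otimes> x) \<otimes> p"
      using that by (intro idem_comm idem_mult_im_inv) (simp_all add: im_inv_props)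
    also have "\<dots> \<otimes> p = (im_inv M x \<otimes> x) \<otimes> p"
      using that by (simp add: im_inv_props m_assoc)
    finally show ?thesis .
  qed
  have pa: "x \<otimes> (y \<otimes> im_inv M y) = ((x \<otimes> y) \<otimes> im_inv M (x \<otimes> y)) \<otimes> x"
    if "x \<in> carrier M" "y \<in> carrier M" for x y
  proof -
    have "((x \<otimes> y) \<otimes> im_inv M (x \<otimes> y)) \<otimes> x = x \<otimes> ((y \<otimes> im_inv M y) \<otimes> (im_inv M x \<otimes> x))"
      using that by (simp add: im_inv_mult im_inv_props m_assoc)
    also have "\<dots> = (x \<otimes> im_inv M x \<otimes> x) \<otimes> (y \<otimes> im_inv M y)"
      unfolding comm2[OF that, symmetric] using that by (simp add: im_inv_props(1) m_assoc)
    finally show ?thesis using that by (simp add: im_inv_props)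
  qed
  have sa: "(im_inv M x \<otimes> x) \<otimes> y = y \<otimes> (im_inv M (x \<otimes> y) \<otimes> (x \<otimes> y))"
    if "x \<in> carrier M" "y \<in> carrier M" for x y
  proof -
    have "y \<otimes> (im_inv M (x \<otimes> y) \<otimes> (x \<otimes> y)) = ((y \<otimes> im_inv M y) \<otimes> (im_inv M x \<otimes> x)) \<otimes> y"
      using that by (simp add: im_inv_mult im_inv_props m_assoc)
    also have "\<dots> = (im_inv M x \<otimes> x) \<otimes> (y \<otimes> im_inv M y \<otimes> y)"
      unfolding comm2[OF that, symmetric] using that by (simp add: im_inv_props(1) m_assoc)
    finally show ?thesis using that by (simp add: im_inv_props)
  qed
  have sp: "im_inv M (x \<otimes> im_inv M x) \<otimes> (x \<otimes> im_inv M x) = x \<otimes> im_inv M x"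
    and ps: "(im_inv M x \<otimes> x) \<otimes> im_inv M (im_inv M x \<otimes> x) = im_inv M x \<otimes> x"
    if "x \<in> carrier M" for x
    using that idem_mult_im_inv[OF that] by (simp_all add: im_inv_idem im_inv_props(1))
  have right: "x \<otimes> (im_inv M x \<otimes> x) = x" if "x \<in> carrier M" for x
    using that by (simp add: im_inv_props m_assoc[symmetric])
  have "monoid (rm_of_im M)"
    by unfold_locales (simp_all add: rm_of_im_def m_assoc)
  then show ?thesis
    by (intro restriction_monoid.intro restriction_monoid_axioms.intro)
      (simp_all add: rm_of_im_def im_inv_props right,
        (rule mult_im_inv_comm im_inv_mult_comm pp ss pa sa sp ps;
          simp add: im_inv_props(1) idem_mult_im_inv)+)
qed

text \<open>The image of an inverse satisfies the inverse equations for the image, so a monoid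
  morphism preserves inverses by their uniqueness, and with them the star and plus built from
  inverses.\<close>

lemma rm_hom_of_im:
  assumes "inverse_monoid N" "\<phi> \<in> hom M N" "\<phi> \<one> = \<one>\<^bsub>N\<^esub>"
  shows "\<phi> \<in> rm_hom (rm_of_im M) (rm_of_im N)"
proof -
  interpret N: inverse_monoid N by fact
  have m: "\<phi> (x \<otimes> y) = \<phi> x \<otimes>\<^bsub>N\<^esub> \<phi> y" and c: "\<phi> x \<in> carrier N"
    if "x \<in> carrier M" "y \<in> carrier M" for x y
    using assms(2) that by (auto simp: hom_def)
  have i: "im_inv N (\<phi> x) = \<phi> (im_inv M x)" if "x \<in> carrier M" for x
    using that im_inv_props[OF that] by (intro N.im_inv_eqI) (auto simp: m[symmetric] c)
  show ?thesis
    using assms(2,3) by (auto simp: rm_hom_def rm_of_im_def hom_def im_inv_props(1) i)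
qed

end

section \<open>Restriction monoids: the semilattice of projections\<close>

context restriction_monoid
begin

lemmas rm_closed = star_closed plus_closed

lemma plus_one: "rplus T \<one> = \<one>"
  using plus_left[of \<one>] plus_closed[of \<one>] by simp

lemma plus_idem: "x \<in> carrier T \<Longrightarrow> rplus T x \<otimes> rplus T x = rplus T x"
  using plus_plus[of x x] plus_left by simp

lemma plus_of_plus: "x \<in> carrier T \<Longrightarrow> rplus T (rplus T x) = rplus T x"
  using plus_plus[of x \<one>] by (simp add: plus_one plus_closed)

lemma plus_mult_plus:
  "\<lbrakk>x \<in> carrier T; y \<in> carrier T\<rbrakk> \<Longrightarrow> rplus T (rplus T x \<otimes> rplus T y) = rplus T x \<otimes> rplus T y"
  by (simp add: plus_plus plus_of_plus plus_closed)

text \<open>The elements are also those of the form \<open>rstar T x\<close>, by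
  \<open>star_of_plus\<close> and \<open>plus_of_star\<close>. They form a structure of their own
  because \<open>finprod\<close> lives in a commutative monoid, which \<open>T\<close> in general is
  not.\<close>

definition projections :: "'a monoid" where
  "projections = \<lparr>carrier = rplus T ` carrier T, mult = (\<otimes>), one = \<one>\<rparr>"

lemma projections_simps:
  "carrier projections = rplus T ` carrier T"
  "x \<otimes>\<^bsub>projections\<^esub> y = x \<otimes> y"
  "\<one>\<^bsub>projections\<^esub> = \<one>"
  by (simp_all add: projections_def)

lemma comm_monoid_projections: "comm_monoid projections"
proof (rule comm_monoidI)
  show "\<one>\<^bsub>projections\<^esub> \<in> carrier projections"
    using plus_one one_closed by (metis imageI projections_simps(1,3))
next
  fix x y assume "x \<in> carrier projections" "y \<in> carrier projections"
  then obtain a b where ab: "a \<in> carrier T" "x = rplus T a" "b \<in> carrier T" "y = rplus T b"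
    by (auto simp: projections_simps)
  then have "rplus T (x \<otimes> y) = x \<otimes> y" "x \<otimes> y \<in> carrier T"
    by (simp_all add: plus_mult_plus plus_closed)
  then show "x \<otimes>\<^bsub>projections\<^esub> y \<in> carrier projections"
    by (metis imageI projections_simps(1,2))
  show "x \<otimes>\<^bsub>projections\<^esub> y = y \<otimes>\<^bsub>projections\<^esub> x"
    using ab by (simp add: projections_simps plus_comm)
qed (auto simp: projections_simps m_assoc plus_closed)

lemma projection_closed: "p \<in> carrier projections \<Longrightarrow> p \<in> carrier T"
  and projection_star: "p \<in> carrier projections \<Longrightarrow> rstar T p = p"
  and projection_idem: "p \<in> carrier projections \<Longrightarrow> p \<otimes> p = p"
  by (auto simp: projections_simps plus_closed plus_of_plus star_of_plus plus_idem)

lemma plus_projection: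
  "\<lbrakk>p \<in> carrier projections; x \<in> carrier T\<rbrakk> \<Longrightarrow> rplus T (p \<otimes> x) = p \<otimes> rplus T x"
  by (auto simp: projections_simps plus_plus)

text \<open>A projection is its own star, so this is an instance of
  \<open>star_star\<close>.\<close>

lemma star_projection:
  "\<lbrakk>p \<in> carrier projections; x \<in> carrier T\<rbrakk> \<Longrightarrow> rstar T (x \<otimes> p) = rstar T x \<otimes> p"
  using star_star[of x p] by (simp add: projection_star projection_closed)

end

section \<open>The prefix expansion: multiplication, plus and star in coordinates\<close>

context group
begin

lemma prefix_expansion_simps:
  "(A, g) \<in> carrier (prefix_expansion G) \<longleftrightarrow>
    g \<in> carrier G \<and> A \<subseteq> carrier G \<and> finite A \<and> \<one> \<in> A \<and> g \<in> A"
  "(A, g) \<otimes>\<^bsub>prefix_expansion G\<^esub> (B, h) = (A \<union> (g <# B), g \<otimes> h)"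
  "\<one>\<^bsub>prefix_expansion G\<^esub> = ({\<one>}, \<one>)"
  by (simp_all add: prefix_expansion_def)

lemma prefix_expansion_plus:
  "(A, g) \<in> carrier (prefix_expansion G) \<Longrightarrow>
    rplus (rm_of_im (prefix_expansion G)) (A, g) = (A, \<one>)"
  by (simp add: rm_of_im_def prefix_expansion_inverse(2))
    (auto simp: prefix_expansion_simps lcos_m_assoc lcos_mult_one)

lemma prefix_expansion_star:
  "(A, g) \<in> carrier (prefix_expansion G) \<Longrightarrow>
    rstar (rm_of_im (prefix_expansion G)) (A, g) = (inv g <# A, \<one>)"
  by (simp add: rm_of_im_def prefix_expansion_inverse(2))
    (auto simp: prefix_expansion_simps)

end

section \<open>Strong premorphisms and the morphism they induce on the prefix expansion\<close>

locale strong_premorphism = G: group G + T: restriction_monoid T for G (structure) and T +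
  fixes f :: "'a \<Rightarrow> 'c"
  assumes f_closed: "g \<in> carrier G \<Longrightarrow> f g \<in> carrier T"
    and f_one: "f \<one> = \<one>\<^bsub>T\<^esub>"
    and f_mult_left: "\<lbrakk>g \<in> carrier G; h \<in> carrier G\<rbrakk> \<Longrightarrow>
      f g \<otimes>\<^bsub>T\<^esub> f h = rplus T (f g) \<otimes>\<^bsub>T\<^esub> f (g \<otimes> h)"
    and f_mult_right: "\<lbrakk>g \<in> carrier G; h \<in> carrier G\<rbrakk> \<Longrightarrow>
      f g \<otimes>\<^bsub>T\<^esub> f h = f (g \<otimes> h) \<otimes>\<^bsub>T\<^esub> rstar T (f h)"
begin

sublocale E: comm_monoid T.projections
  by (rule T.comm_monoid_projections)

definition e :: "'a \<Rightarrow> 'c" where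
  "e g = rplus T (f g)"

text \<open>This is the meet of the projections \<open>e a\<close> for \<open>a\<close> in
  \<open>A\<close>, when \<open>A\<close> is finite. For infinite \<open>A\<close> the value is the
  default \<open>\<one>\<close> of \<open>finprod\<close>.\<close>

definition P :: "'a set \<Rightarrow> 'c" where
  "P A = finprod T.projections e A"

definition psi :: "'a set \<times> 'a \<Rightarrow> 'c" where
  "psi = (\<lambda>(A, g). P A \<otimes>\<^bsub>T\<^esub> f g)"

lemma e_projection: "g \<in> carrier G \<Longrightarrow> e g \<in> carrier T.projections"
  by (simp add: e_def T.projections_simps f_closed)

lemma e_closed: "g \<in> carrier G \<Longrightarrow> e g \<in> carrier T"
  by (simp add: e_projection T.projection_closed)

lemma e_one: "e \<one> = \<one>\<^bsub>T\<^esub>"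
  by (simp add: e_def f_one T.plus_one)

lemma e_f: "g \<in> carrier G \<Longrightarrow> e g \<otimes>\<^bsub>T\<^esub> f g = f g"
  by (simp add: e_def T.plus_left f_closed)

lemma P_projection: "A \<subseteq> carrier G \<Longrightarrow> P A \<in> carrier T.projections"
  unfolding P_def by (rule E.finprod_closed) (auto intro: e_projection)

lemma P_closed: "A \<subseteq> carrier G \<Longrightarrow> P A \<in> carrier T"
  by (simp add: P_projection T.projection_closed)

lemma projection_comm:
  "\<lbrakk>p \<in> carrier T.projections; q \<in> carrier T.projections\<rbrakk> \<Longrightarrow> p \<otimes>\<^bsub>T\<^esub> q = q \<otimes>\<^bsub>T\<^esub> p"
  using E.m_comm[of p q] by (simp add: T.projections_simps)

lemma P_empty: "P {} = \<one>\<^bsub>T\<^esub>"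
  by (simp add: P_def T.projections_simps)

text \<open>For \<open>g\<close> outside \<open>A\<close> this is \<open>finprod_insert\<close>. For
  \<open>g\<close> in \<open>A\<close> the extra factor \<open>e g\<close> disappears because
  projections are idempotent.\<close>

lemma P_insert:
  assumes "finite A" "A \<subseteq> carrier G" "g \<in> carrier G"
  shows "P (insert g A) = e g \<otimes>\<^bsub>T\<^esub> P A"
proof -
  have *: "P (insert g B) = e g \<otimes>\<^bsub>T\<^esub> P B" if "g \<notin> B" "finite B" "B \<subseteq> carrier G" for B
    unfolding P_def using that assms(3) e_projection
    by (subst E.finprod_insert) (auto simp: T.projections_simps(2))
  show ?thesis
  proof (cases "g \<in> A")
    case True
    then have "P A = e g \<otimes>\<^bsub>T\<^esub> P (A - {g})"
      using *[of "A - {g}"] assms by (auto simp: insert_absorb)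
    moreover have "e g \<otimes>\<^bsub>T\<^esub> (e g \<otimes>\<^bsub>T\<^esub> P (A - {g})) = e g \<otimes>\<^bsub>T\<^esub> P (A - {g})"
      using assms P_closed[OF subset_trans[OF Diff_subset assms(2)]]
      by (simp add: T.m_assoc[symmetric] T.projection_idem e_projection e_closed)
    ultimately show ?thesis using True by (simp add: insert_absorb)
  qed (use * assms in auto)
qed

lemma P_Un:
  assumes "finite A" "A \<subseteq> carrier G" "finite B" "B \<subseteq> carrier G"
  shows "P (A \<union> B) = P A \<otimes>\<^bsub>T\<^esub> P B"
  using assms
proof (induction A rule: finite_induct)
  case empty
  then show ?case by (simp add: P_empty P_closed)
next
  case (insert a A)
  then show ?case
    by (simp add: P_insert T.m_assoc e_closed P_closed)
qed

text \<open>The factor \<open>e g\<close> already occurs in \<open>P A\<close>, and inserting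
  \<open>g\<close> into \<open>A\<close> again changes nothing.\<close>

lemma P_absorb:
  "\<lbrakk>finite A; A \<subseteq> carrier G; g \<in> A\<rbrakk> \<Longrightarrow> P A \<otimes>\<^bsub>T\<^esub> e g = P A"
  using P_insert[of A g] projection_comm[OF P_projection e_projection, of A g]
  by (auto simp: insert_absorb)

text \<open>The ample identity moves \<open>f g\<close> to the right of the plus of
  \<open>f g \<otimes> f a\<close>. The left premorphism law evaluates this plus to
  \<open>e g \<otimes> e (g \<otimes> a)\<close>, and \<open>f g\<close> absorbs the factor
  \<open>e g\<close>.\<close>

lemma f_e:
  assumes "g \<in> carrier G" "a \<in> carrier G"
  shows "f g \<otimes>\<^bsub>T\<^esub> e a = e (g \<otimes> a) \<otimes>\<^bsub>T\<^esub> f g"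
proof -
  have "f g \<otimes>\<^bsub>T\<^esub> e a = rplus T (f g \<otimes>\<^bsub>T\<^esub> f a) \<otimes>\<^bsub>T\<^esub> f g"
    unfolding e_def using assms f_closed by (intro T.plus_ample) auto
  also have "rplus T (f g \<otimes>\<^bsub>T\<^esub> f a) = e g \<otimes>\<^bsub>T\<^esub> e (g \<otimes> a)"
    unfolding f_mult_left[OF assms] e_def using assms f_closed by (intro T.plus_plus) auto
  also have "\<dots> = e (g \<otimes> a) \<otimes>\<^bsub>T\<^esub> e g"
    using assms by (intro projection_comm e_projection) auto
  finally show ?thesis
    using assms by (simp add: T.m_assoc e_closed f_closed e_f)
qed

lemma f_P:
  assumes "finite B" "B \<subseteq> carrier G" "g \<in> carrier G"
  shows "f g \<otimes>\<^bsub>T\<^esub> P B = P (g <# B) \<otimes>\<^bsub>T\<^esub> f g"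
  using assms
proof (induction B rule: finite_induct)
  case empty
  then show ?case by (simp add: P_empty f_closed l_coset_def)
next
  case (insert b B)
  have coset: "g <# insert b B = insert (g \<otimes> b) (g <# B)" "finite (g <# B)" "g <# B \<subseteq> carrier G"
    using insert by (auto simp: l_coset_def)
  have "f g \<otimes>\<^bsub>T\<^esub> P (insert b B) = (f g \<otimes>\<^bsub>T\<^esub> e b) \<otimes>\<^bsub>T\<^esub> P B"
    using insert by (simp add: P_insert T.m_assoc e_closed f_closed P_closed)
  also have "\<dots> = e (g \<otimes> b) \<otimes>\<^bsub>T\<^esub> (f g \<otimes>\<^bsub>T\<^esub> P B)"
    using insert by (simp add: f_e T.m_assoc e_closed f_closed P_closed)
  also have "\<dots> = P (g <# insert b B) \<otimes>\<^bsub>T\<^esub> f g"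
    using insert coset by (simp add: P_insert T.m_assoc e_closed f_closed P_closed)
  finally show ?case .
qed

text \<open>For the pair \<open>inv g\<close>, \<open>g\<close> both premorphism laws compute the
  same product: the left law gives \<open>e (inv g)\<close>, the right law gives the star of
  \<open>f g\<close>, since \<open>f \<one>\<close> is the identity.\<close>

lemma star_f: "g \<in> carrier G \<Longrightarrow> rstar T (f g) = e (inv g)"
  using f_mult_left[of "inv g" g] f_mult_right[of "inv g" g]
  by (simp add: f_one e_def f_closed T.star_closed T.plus_closed)

lemma psi_hom: "psi \<in> rm_hom (rm_of_im (prefix_expansion G)) T"
proof -
  let ?PE = "rm_of_im (prefix_expansion G)"
  have PE: "carrier ?PE = carrier (prefix_expansion G)"
    "x \<otimes>\<^bsub>?PE\<^esub> y = x \<otimes>\<^bsub>prefix_expansion G\<^esub> y" "\<one>\<^bsub>?PE\<^esub> = \<one>\<^bsub>prefix_expansion G\<^esub>" for x y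
    by (simp_all add: rm_of_im_def)
  have psi: "psi (A, g) = P A \<otimes>\<^bsub>T\<^esub> f g" for A g
    by (simp add: psi_def)
  note cl = e_closed f_closed P_closed
  have mult: "psi ((A, g) \<otimes>\<^bsub>?PE\<^esub> (B, h)) = psi (A, g) \<otimes>\<^bsub>T\<^esub> psi (B, h)"
    if "(A, g) \<in> carrier ?PE" "(B, h) \<in> carrier ?PE" for A g B h
  proof -
    from that have c [simp]: "g \<in> carrier G" "A \<subseteq> carrier G" "finite A" "g \<in> A"
      "h \<in> carrier G" "B \<subseteq> carrier G" "finite B" "\<one> \<in> B"
      by (auto simp: PE G.prefix_expansion_simps)
    have gB [simp]: "finite (g <# B)" "g <# B \<subseteq> carrier G" "g \<in> g <# B"
      using c G.l_coset_subset_G by (auto simp: l_coset_def intro: bexI[of _ \<one>])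
    have "psi (A, g) \<otimes>\<^bsub>T\<^esub> psi (B, h) = P A \<otimes>\<^bsub>T\<^esub> (f g \<otimes>\<^bsub>T\<^esub> P B) \<otimes>\<^bsub>T\<^esub> f h"
      by (simp add: psi T.m_assoc cl)
    also have "\<dots> = P A \<otimes>\<^bsub>T\<^esub> P (g <# B) \<otimes>\<^bsub>T\<^esub> (f g \<otimes>\<^bsub>T\<^esub> f h)"
      by (simp add: f_P T.m_assoc cl)
    also have "f g \<otimes>\<^bsub>T\<^esub> f h = e g \<otimes>\<^bsub>T\<^esub> f (g \<otimes> h)"
      by (simp add: f_mult_left e_def)
    \<comment> \<open>The factor \<open>e g\<close> left over by the premorphism law is absorbed by
      \<open>P (g <# B)\<close>: as \<open>\<one>\<close> lies in \<open>B\<close>, the element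
      \<open>g\<close> lies in \<open>g <# B\<close>.\<close>
    also have "P A \<otimes>\<^bsub>T\<^esub> P (g <# B) \<otimes>\<^bsub>T\<^esub> \<dots> = P A \<otimes>\<^bsub>T\<^esub> (P (g <# B) \<otimes>\<^bsub>T\<^esub> e g) \<otimes>\<^bsub>T\<^esub> f (g \<otimes> h)"
      by (simp add: T.m_assoc cl)
    also have "P A \<otimes>\<^bsub>T\<^esub> (P (g <# B) \<otimes>\<^bsub>T\<^esub> e g) = P (A \<union> (g <# B))"
      by (simp add: P_absorb P_Un)
    finally show ?thesis by (simp add: PE G.prefix_expansion_simps psi)
  qed
  have star: "psi (rstar ?PE (A, g)) = rstar T (psi (A, g))"
    and plus: "psi (rplus ?PE (A, g)) = rplus T (psi (A, g))"
    if "(A, g) \<in> carrier ?PE" for A g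
  proof -
    from that have c [simp]: "g \<in> carrier G" "A \<subseteq> carrier G" "finite A" "g \<in> A" "\<one> \<in> A"
      by (auto simp: PE G.prefix_expansion_simps)
    have gA [simp]: "finite (inv g <# A)" "inv g <# A \<subseteq> carrier G" "inv g \<in> inv g <# A"
      using c G.l_coset_subset_G by (auto simp: l_coset_def intro: bexI[of _ \<one>])
    \<comment> \<open>Writing \<open>A\<close> as \<open>g <# (inv g <# A)\<close> lets
      \<open>f_P\<close> carry the projection to the right of \<open>f g\<close>, where
      \<open>star_projection\<close> applies.\<close>
    have "psi (A, g) = f g \<otimes>\<^bsub>T\<^esub> P (inv g <# A)"
      by (simp add: f_P psi G.lcos_m_assoc G.lcos_mult_one)
    then have "rstar T (psi (A, g)) = e (inv g) \<otimes>\<^bsub>T\<^esub> P (inv g <# A)"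
      by (simp add: T.star_projection P_projection f_closed star_f)
    \<comment> \<open>Since \<open>\<one>\<close> lies in \<open>A\<close>, the element
      \<open>inv g\<close> lies in \<open>inv g <# A\<close>, so \<open>e (inv g)\<close> is
      absorbed.\<close>
    also have "\<dots> = P (inv g <# A)"
      by (simp add: P_absorb P_projection e_projection projection_comm[of "e (inv g)"])
    finally show "psi (rstar ?PE (A, g)) = rstar T (psi (A, g))"
      using that by (simp add: G.prefix_expansion_star PE psi f_one cl)
    have "rplus T (psi (A, g)) = P A \<otimes>\<^bsub>T\<^esub> e g"
      by (simp add: psi T.plus_projection P_projection f_closed e_def)
    then show "psi (rplus ?PE (A, g)) = rplus T (psi (A, g))"
      using that by (simp add: G.prefix_expansion_plus PE psi f_one cl P_absorb)
  qed
  have "psi (A, g) \<in> carrier T" if "(A, g) \<in> carrier ?PE" for A g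
    using that by (simp add: psi PE G.prefix_expansion_simps cl)
  moreover have "psi \<one>\<^bsub>?PE\<^esub> = \<one>\<^bsub>T\<^esub>"
    by (simp add: PE G.prefix_expansion_simps psi P_insert P_empty e_one f_one)
  ultimately show ?thesis
    using mult star plus by (simp add: rm_hom_def hom_def Pi_iff split_paired_all)
qed

lemma psi_generator: "g \<in> carrier G \<Longrightarrow> psi ({\<one>, g}, g) = f g"
  by (simp add: psi_def P_insert P_empty e_one e_closed e_f)

text \<open>The values of \<open>\<theta>\<close> on the generators determine it on each
  \<open>e g\<close>, hence on each \<open>P A\<close>. Multiplying the value on \<open>P A\<close>
  by \<open>({\<one>, g}, g)\<close> returns \<open>(A, g)\<close>, because \<open>\<one>\<close>
  and \<open>g\<close> belong to \<open>A\<close>.\<close>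

lemma psi_left_inverse:
  assumes theta: "\<theta> \<in> rm_hom T (rm_of_im (prefix_expansion G))"
    and gen: "\<And>g. g \<in> carrier G \<Longrightarrow> \<theta> (f g) = ({\<one>, g}, g)"
    and x: "x \<in> carrier (prefix_expansion G)"
  shows "\<theta> (psi x) = x"
proof -
  let ?PE = "prefix_expansion G"
  have mult: "\<theta> (s \<otimes>\<^bsub>T\<^esub> t) = \<theta> s \<otimes>\<^bsub>?PE\<^esub> \<theta> t" if "s \<in> carrier T" "t \<in> carrier T" for s t
    using theta that by (simp add: rm_hom_def hom_def rm_of_im_def)
  have one: "\<theta> \<one>\<^bsub>T\<^esub> = ({\<one>}, \<one>)"
    using theta by (simp add: rm_hom_def rm_of_im_def prefix_expansion_def)
  have "\<theta> (e g) = rplus (rm_of_im ?PE) (\<theta> (f g))" if "g \<in> carrier G" for g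
    using theta that f_closed unfolding rm_hom_def e_def by blast
  then have e: "\<theta> (e g) = ({\<one>, g}, \<one>)" if "g \<in> carrier G" for g
    using that by (simp add: gen G.prefix_expansion_plus G.prefix_expansion_simps)
  \<comment> \<open>\<open>A\<close> need not contain \<open>\<one>\<close> during the induction,
    and the empty product goes to \<open>({\<one>}, \<one>)\<close>; hence
    \<open>insert \<one> A\<close>.\<close>
  have P: "\<theta> (P A) = (insert \<one> A, \<one>)" if "finite A" "A \<subseteq> carrier G" for A
    using that
  proof (induction A rule: finite_induct)
    case empty
    then show ?case by (simp add: P_empty one)
  next
    case (insert a A)
    then have "\<theta> (P (insert a A)) = ({\<one>, a}, \<one>) \<otimes>\<^bsub>?PE\<^esub> (insert \<one> A, \<one>)"
      by (simp add: P_insert mult e e_closed P_closed)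
    then show ?case
      using insert.prems by (auto simp: G.prefix_expansion_simps G.lcos_mult_one)
  qed
  obtain A g where "x = (A, g)" by fastforce
  with x show ?thesis
    by (auto simp: psi_def mult f_closed P_closed P gen G.prefix_expansion_simps G.lcos_mult_one)
qed

text \<open>The left inverse \<open>\<theta>\<close> makes \<open>psi\<close> injective.
  Surjectivity is left as a hypothesis: it depends on how \<open>T\<close> is generated and is
  checked by induction on terms for each presentation.\<close>

lemma rm_isomorphic_prefix_expansion:
  assumes "\<theta> \<in> rm_hom T (rm_of_im (prefix_expansion G))"
    and "\<And>g. g \<in> carrier G \<Longrightarrow> \<theta> (f g) = ({\<one>, g}, g)"
    and surj: "carrier T \<subseteq> psi ` carrier (prefix_expansion G)"
  shows "rm_isomorphic (rm_of_im (prefix_expansion G)) T"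
  unfolding rm_isomorphic_def
proof (rule bexI[OF _ psi_hom])
  have "psi ` carrier (prefix_expansion G) \<subseteq> carrier T"
    using psi_hom by (auto simp: rm_hom_def hom_def rm_of_im_def)
  moreover have "inj_on psi (carrier (prefix_expansion G))"
    using psi_left_inverse[OF assms(1,2)] by (rule inj_on_inverseI)
  ultimately show "bij_betw psi (carrier (rm_of_im (prefix_expansion G))) (carrier T)"
    using surj by (auto simp: bij_betw_def rm_of_im_def)
qed

end

section \<open>Isomorphisms of restriction monoids and transport of inverses\<close>

lemma rm_isomorphic_sym:
  assumes S: "restriction_monoid S" and iso: "rm_isomorphic S T"
  shows "rm_isomorphic T S"
proof -
  interpret S: restriction_monoid S by (rule S)
  obtain \<phi> where \<phi>: "\<phi> \<in> rm_hom S T" and bij: "bij_betw \<phi> (carrier S) (carrier T)"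
    using iso by (auto simp: rm_isomorphic_def)
  define \<psi> where "\<psi> = inv_into (carrier S) \<phi>"
  have bij': "bij_betw \<psi> (carrier T) (carrier S)"
    unfolding \<psi>_def by (rule bij_betw_inv_into[OF bij])
  have \<phi>\<psi>: "\<phi> (\<psi> x) = x" and \<psi>_closed: "\<psi> x \<in> carrier S" if "x \<in> carrier T" for x
    using that bij bij' by (auto simp: \<psi>_def bij_betw_inv_into_right dest: bij_betwE)
  have \<psi>\<phi>: "\<psi> (\<phi> x) = x" if "x \<in> carrier S" for x
    using that bij by (simp add: \<psi>_def bij_betw_inv_into_left)
  have "\<psi> \<in> rm_hom T S"
    unfolding rm_hom_def hom_def
  proof (intro CollectI conjI ballI)
    show "\<psi> \<in> carrier T \<rightarrow> carrier S" using \<psi>_closed by blast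
    show "\<psi> \<one>\<^bsub>T\<^esub> = \<one>\<^bsub>S\<^esub>"
      using \<phi> \<psi>\<phi>[of "\<one>\<^bsub>S\<^esub>"] by (simp add: rm_hom_def)
  next
    fix x y assume xy: "x \<in> carrier T" "y \<in> carrier T"
    have "\<phi> (\<psi> x \<otimes>\<^bsub>S\<^esub> \<psi> y) = x \<otimes>\<^bsub>T\<^esub> y"
      using \<phi> xy by (simp add: rm_hom_def hom_def \<psi>_closed \<phi>\<psi>)
    then show "\<psi> (x \<otimes>\<^bsub>T\<^esub> y) = \<psi> x \<otimes>\<^bsub>S\<^esub> \<psi> y"
      using xy \<psi>\<phi>[of "\<psi> x \<otimes>\<^bsub>S\<^esub> \<psi> y"] by (simp add: \<psi>_closed)
  next
    fix x assume x: "x \<in> carrier T"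
    \<comment> \<open>Cancelling \<open>\<phi>\<close> here requires the arguments to lie in
      \<open>carrier S\<close>, which is closed under star and plus because \<open>S\<close> is a
      restriction monoid.\<close>
    have "\<phi> (rstar S (\<psi> x)) = rstar T x" "\<phi> (rplus S (\<psi> x)) = rplus T x"
      using \<phi> x by (simp_all add: rm_hom_def \<psi>_closed \<phi>\<psi>)
    then show "\<psi> (rstar T x) = rstar S (\<psi> x)" "\<psi> (rplus T x) = rplus S (\<psi> x)"
      using x \<psi>\<phi>[of "rstar S (\<psi> x)"] \<psi>\<phi>[of "rplus S (\<psi> x)"]
      by (simp_all add: \<psi>_closed S.rm_closed)
  qed
  with bij' show ?thesis by (auto simp: rm_isomorphic_def)
qed

lemma rm_isomorphic_trans:
  assumes "rm_isomorphic S T" "rm_isomorphic T U"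
  shows "rm_isomorphic S U"
proof -
  obtain \<phi> \<psi> where "\<phi> \<in> rm_hom S T" "bij_betw \<phi> (carrier S) (carrier T)"
    and "\<psi> \<in> rm_hom T U" "bij_betw \<psi> (carrier T) (carrier U)"
    using assms by (auto simp: rm_isomorphic_def)
  then have "\<psi> \<circ> \<phi> \<in> rm_hom S U" "bij_betw (\<psi> \<circ> \<phi>) (carrier S) (carrier U)"
    by (auto simp: rm_hom_def hom_def Pi_iff intro: bij_betw_trans)
  then show ?thesis by (auto simp: rm_isomorphic_def)
qed

text \<open>Existence of inverses is transported along the isomorphism, and uniqueness is pulled
  back by injectivity. The last two conclusions identify the given star and plus of \<open>T\<close>
  with those coming from its inverses.\<close>

lemma rm_isomorphic_inverse_monoid:
  assumes "inverse_monoid M" "restriction_monoid T" and iso: "rm_isomorphic (rm_of_im M) T"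
  shows "inverse_monoid T"
    and "a \<in> carrier T \<Longrightarrow> rstar T a = im_inv T a \<otimes>\<^bsub>T\<^esub> a"
    and "a \<in> carrier T \<Longrightarrow> rplus T a = a \<otimes>\<^bsub>T\<^esub> im_inv T a"
proof -
  interpret M: inverse_monoid M by fact
  interpret T: restriction_monoid T by fact
  obtain \<phi> where \<phi>: "\<phi> \<in> rm_hom (rm_of_im M) T" and bij: "bij_betw \<phi> (carrier M) (carrier T)"
    using iso by (auto simp: rm_isomorphic_def rm_of_im_def)
  have m: "\<phi> (x \<otimes>\<^bsub>M\<^esub> y) = \<phi> x \<otimes>\<^bsub>T\<^esub> \<phi> y" if "x \<in> carrier M" "y \<in> carrier M" for x y
    using \<phi> that by (simp add: rm_hom_def hom_def rm_of_im_def)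
  have cl: "\<phi> x \<in> carrier T" if "x \<in> carrier M" for x
    using bij that by (auto dest: bij_betwE)
  have eq: "\<phi> x = \<phi> y \<longleftrightarrow> x = y" if "x \<in> carrier M" "y \<in> carrier M" for x y
    using bij that by (auto simp: bij_betw_def inj_on_eq_iff)
  have surj: "\<exists>x \<in> carrier M. a = \<phi> x" if "a \<in> carrier T" for a
    using bij that by (auto simp: bij_betw_def)
  show T: "inverse_monoid T"
  proof
    fix a assume "a \<in> carrier T"
    then obtain x where x: "x \<in> carrier M" and a: "a = \<phi> x" using surj by blast
    show "\<exists>!b. b \<in> carrier T \<and> a \<otimes>\<^bsub>T\<^esub> b \<otimes>\<^bsub>T\<^esub> a = a \<and> b \<otimes>\<^bsub>T\<^esub> a \<otimes>\<^bsub>T\<^esub> b = b"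
    proof (rule ex1I[of _ "\<phi> (im_inv M x)"])
      show "\<phi> (im_inv M x) \<in> carrier T \<and> a \<otimes>\<^bsub>T\<^esub> \<phi> (im_inv M x) \<otimes>\<^bsub>T\<^esub> a = a \<and>
          \<phi> (im_inv M x) \<otimes>\<^bsub>T\<^esub> a \<otimes>\<^bsub>T\<^esub> \<phi> (im_inv M x) = \<phi> (im_inv M x)"
        using x M.im_inv_props[OF x] by (simp add: a cl m[symmetric])
    next
      fix b assume b: "b \<in> carrier T \<and> a \<otimes>\<^bsub>T\<^esub> b \<otimes>\<^bsub>T\<^esub> a = a \<and> b \<otimes>\<^bsub>T\<^esub> a \<otimes>\<^bsub>T\<^esub> b = b"
      then obtain y where y: "y \<in> carrier M" "b = \<phi> y" using surj by blast
      with b x have "x \<otimes>\<^bsub>M\<^esub> y \<otimes>\<^bsub>M\<^esub> x = x \<and> y \<otimes>\<^bsub>M\<^esub> x \<otimes>\<^bsub>M\<^esub> y = y"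
        by (simp add: a m[symmetric] eq)
      with x y show "b = \<phi> (im_inv M x)" by (simp add: M.im_inv_eqI)
    qed
  qed
  have i: "im_inv T (\<phi> x) = \<phi> (im_inv M x)" if "x \<in> carrier M" for x
    using that M.im_inv_props[OF that]
    by (intro inverse_monoid.im_inv_eqI[OF T]) (simp_all add: cl m[symmetric])
  show "rstar T a = im_inv T a \<otimes>\<^bsub>T\<^esub> a" "rplus T a = a \<otimes>\<^bsub>T\<^esub> im_inv T a" if a: "a \<in> carrier T"
  proof -
    obtain x where x: "x \<in> carrier M" "a = \<phi> x" using surj[OF a] by blast
    have "\<phi> (im_inv M x \<otimes>\<^bsub>M\<^esub> x) = rstar T (\<phi> x)" "\<phi> (x \<otimes>\<^bsub>M\<^esub> im_inv M x) = rplus T (\<phi> x)"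
      using \<phi> x by (simp_all add: rm_hom_def rm_of_im_def)
    with x show "rstar T a = im_inv T a \<otimes>\<^bsub>T\<^esub> a" "rplus T a = a \<otimes>\<^bsub>T\<^esub> im_inv T a"
      by (simp_all add: i m M.im_inv_props(1))
  qed
qed

section \<open>Evaluation of terms and the universal properties of the presentations\<close>

primrec reval :: "('b, 'm) rmonoid_scheme \<Rightarrow> ('x \<Rightarrow> 'b) \<Rightarrow> 'x rterm \<Rightarrow> 'b" where
  "reval T v (RGen x) = v x"
| "reval T v ROne = \<one>\<^bsub>T\<^esub>"
| "reval T v (RMul s t) = reval T v s \<otimes>\<^bsub>T\<^esub> reval T v t"
| "reval T v (RStar s) = rstar T (reval T v s)"
| "reval T v (RPlus s) = rplus T (reval T v s)"

primrec ieval :: "('b, 'm) monoid_scheme \<Rightarrow> ('x \<Rightarrow> 'b) \<Rightarrow> 'x iterm \<Rightarrow> 'b" where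
  "ieval M v (IGen x) = v x"
| "ieval M v IOne = \<one>\<^bsub>M\<^esub>"
| "ieval M v (IMul s t) = ieval M v s \<otimes>\<^bsub>M\<^esub> ieval M v t"
| "ieval M v (IInv s) = im_inv M (ieval M v s)"

text \<open>Each rule generating the congruence is respected by evaluation in \<open>T\<close>: the
  relations by hypothesis, the identities because \<open>T\<close> is a restriction monoid.
  Evaluation therefore descends to classes.\<close>

lemma presented_rm_lift:
  assumes T: "restriction_monoid T" and v: "\<And>x. x \<in> X \<Longrightarrow> v x \<in> carrier T"
    and R: "\<And>s t. (s, t) \<in> R \<Longrightarrow> s \<in> rterms X \<Longrightarrow> t \<in> rterms X \<Longrightarrow> reval T v s = reval T v t"
  shows "\<exists>\<theta> \<in> rm_hom (presented_rm X R) T. \<forall>x \<in> X. \<theta> (rt_cong_rel X R `` {RGen x}) = v x"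
proof -
  interpret T: restriction_monoid T by (rule T)
  have closed: "reval T v s \<in> carrier T" if "s \<in> rterms X" for s
    using that by (induction s) (auto simp: v T.rm_closed)
  have cong: "reval T v s = reval T v t" if "rt_cong X R s t" for s t
    using that
    by induction
      (auto simp: closed R T.rm_closed T.m_assoc T.plus_left T.star_right T.plus_plus
        T.star_star T.star_of_plus T.plus_of_star
        intro: T.plus_comm T.star_comm T.plus_ample T.star_ample)
  \<comment> \<open>A class is evaluated at an arbitrary representative; by \<open>cong\<close> the
    choice does not matter.\<close>
  define \<theta> where "\<theta> = (\<lambda>A. reval T v (SOME s. s \<in> A))"
  have \<theta>: "\<theta> (rt_cong_rel X R `` {s}) = reval T v s" if "s \<in> rterms X" for s
  proof -
    have "s \<in> rt_cong_rel X R `` {s}"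
      using that by (simp add: rt_cong_rel_def rt_cong.refl)
    then have "(SOME t. t \<in> rt_cong_rel X R `` {s}) \<in> rt_cong_rel X R `` {s}"
      by (rule someI)
    then show ?thesis
      by (auto simp: \<theta>_def rt_cong_rel_def dest: cong)
  qed
  have "\<theta> \<in> rm_hom (presented_rm X R) T"
    unfolding rm_hom_def hom_def
    by (auto simp: presented_rm_simps \<theta> closed elim!: quotientE del: equalityI)
  then show ?thesis by (rule bexI[rotated]) (simp add: \<theta>)
qed

text \<open>Evaluation descends to classes because \<open>M\<close> satisfies the identities of
  inverse monoids. Only the product and identity have to be checked for the resulting map;
  \<open>rm_hom_of_im\<close> supplies star and plus.\<close>

lemma presented_im_lift:
  assumes M: "inverse_monoid M" and v: "\<And>x. x \<in> X \<Longrightarrow> v x \<in> carrier M"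
    and R: "\<And>s t. (s, t) \<in> R \<Longrightarrow> s \<in> iterms X \<Longrightarrow> t \<in> iterms X \<Longrightarrow> ieval M v s = ieval M v t"
  shows "\<exists>\<theta> \<in> rm_hom (rm_of_im (presented_im X R)) (rm_of_im M).
    \<forall>x \<in> X. \<theta> (it_cong_rel X R `` {IGen x}) = v x"
proof -
  interpret M: inverse_monoid M by (rule M)
  have closed: "ieval M v s \<in> carrier M" if "s \<in> iterms X" for s
    using that by (induction s) (auto simp: v M.im_inv_props(1))
  have cong: "ieval M v s = ieval M v t" if "it_cong X R s t" for s t
    using that
  proof induction
    \<comment> \<open>Associativity is kept apart, since reassociating in the other cases would
      break the left-bracketed products that \<open>M.im_inv_props\<close> rewrites.\<close>
    case (assoc s t u)
    then show ?case by (simp add: closed M.m_assoc)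
  qed (auto simp: closed R M.im_inv_props M.im_inv_mult intro: M.mult_im_inv_comm)
  define \<theta> where "\<theta> = (\<lambda>A. ieval M v (SOME s. s \<in> A))"
  have \<theta>: "\<theta> (it_cong_rel X R `` {s}) = ieval M v s" if "s \<in> iterms X" for s
  proof -
    have "s \<in> it_cong_rel X R `` {s}"
      using that by (simp add: it_cong_rel_def it_cong.refl)
    then have "(SOME t. t \<in> it_cong_rel X R `` {s}) \<in> it_cong_rel X R `` {s}"
      by (rule someI)
    then show ?thesis
      by (auto simp: \<theta>_def it_cong_rel_def dest: cong)
  qed
  have "\<theta> \<in> rm_hom (rm_of_im (presented_im X R)) (rm_of_im M)"
    by (rule inverse_monoid.rm_hom_of_im[OF inverse_monoid_presented_im M])
      (auto simp: hom_def presented_im_simps \<theta> closed elim!: quotientE del: equalityI)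
  then show ?thesis by (rule bexI[rotated]) (simp add: \<theta>)
qed

section \<open>The prefix expansion compared with the two presentations\<close>

lemma (in group) prefix_expansion_generators:
  fixes v defines "v \<equiv> \<lambda>g. ({\<one>, g}, g)"
  assumes g: "g \<in> carrier G"
  shows "v g \<in> carrier (prefix_expansion G)"
    and "im_inv (prefix_expansion G) (v g) = v (inv g)"
    and "h \<in> carrier G \<Longrightarrow> v g \<otimes>\<^bsub>prefix_expansion G\<^esub> v h =
      v g \<otimes>\<^bsub>prefix_expansion G\<^esub> v (inv g) \<otimes>\<^bsub>prefix_expansion G\<^esub> v (g \<otimes> h)"
    and "h \<in> carrier G \<Longrightarrow> v g \<otimes>\<^bsub>prefix_expansion G\<^esub> v h =
      v (g \<otimes> h) \<otimes>\<^bsub>prefix_expansion G\<^esub> (v (inv h) \<otimes>\<^bsub>prefix_expansion G\<^esub> v h)"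
proof -
  show 1: "v g \<in> carrier (prefix_expansion G)"
    using g by (simp add: v_def prefix_expansion_def)
  have coset: "g <# B = (\<lambda>b. g \<otimes> b) ` B" for g B
    by (auto simp: l_coset_def)
  show "im_inv (prefix_expansion G) (v g) = v (inv g)"
    using 1 g by (auto simp: v_def prefix_expansion_inverse(2) coset)
  \<comment> \<open>In this law and in the next one both sides equal
    \<open>({\<one>, g, g \<otimes> h}, g \<otimes> h)\<close>. Together they are the strong
    premorphism laws for \<open>v\<close>, with \<open>v (inv g)\<close> standing for the inverse of
    \<open>v g\<close>.\<close>
  show "v g \<otimes>\<^bsub>prefix_expansion G\<^esub> v h =
      v g \<otimes>\<^bsub>prefix_expansion G\<^esub> v (inv g) \<otimes>\<^bsub>prefix_expansion G\<^esub> v (g \<otimes> h)"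
    if "h \<in> carrier G"
    using g that by (auto simp: v_def prefix_expansion_def coset)
  show "v g \<otimes>\<^bsub>prefix_expansion G\<^esub> v h =
      v (g \<otimes> h) \<otimes>\<^bsub>prefix_expansion G\<^esub> (v (inv h) \<otimes>\<^bsub>prefix_expansion G\<^esub> v h)"
    if "h \<in> carrier G"
    using g that by (auto simp: v_def prefix_expansion_def coset m_assoc)
qed

lemma (in group) FR_isomorphic_prefix_expansion:
  "rm_isomorphic (rm_of_im (prefix_expansion G)) (FR G)"
proof -
  let ?PE = "prefix_expansion G"
  let ?X = "carrier G"
  let ?c = "\<lambda>s. rt_cong_rel ?X (FR_relations G) `` {s}"
  note simps = presented_rm_simps[where X = ?X and R = "FR_relations G", folded FR_def]
  interpret PE: inverse_monoid ?PE by (rule prefix_expansion_inverse)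
  interpret T: restriction_monoid "FR G"
    unfolding FR_def by (rule restriction_monoid_presented_rm)
  have rel: "?c s = ?c t" if "(s, t) \<in> FR_relations G" "s \<in> rterms ?X" "t \<in> rterms ?X" for s t
    using that by (simp add: rt_cong_class_eq_iff rt_cong.rel)
  \<comment> \<open>The locale laws for the classes of the generators are precisely the defining
    relations of \<open>FR G\<close>.\<close>
  interpret strong_premorphism G "FR G" "\<lambda>g. ?c (RGen g)"
  proof unfold_locales
    fix g h assume gh: "g \<in> ?X" "h \<in> ?X"
    then show "?c (RGen g) \<in> carrier (FR G)" by (simp add: simps quotientI)
    show "?c (RGen g) \<otimes>\<^bsub>FR G\<^esub> ?c (RGen h) = rplus (FR G) (?c (RGen g)) \<otimes>\<^bsub>FR G\<^esub> ?c (RGen (g \<otimes> h))"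
      "?c (RGen g) \<otimes>\<^bsub>FR G\<^esub> ?c (RGen h) = ?c (RGen (g \<otimes> h)) \<otimes>\<^bsub>FR G\<^esub> rstar (FR G) (?c (RGen h))"
      using gh
      by (simp_all add: simps) (rule rel; auto simp: FR_relations_def)+
  next
    show "?c (RGen \<one>) = \<one>\<^bsub>FR G\<^esub>"
      unfolding simps by (intro rel) (auto simp: FR_relations_def)
  qed
  obtain \<theta> where \<theta>: "\<theta> \<in> rm_hom (FR G) (rm_of_im ?PE)"
    "\<And>g. g \<in> ?X \<Longrightarrow> \<theta> (?c (RGen g)) = ({\<one>, g}, g)"
  proof -
    have "reval (rm_of_im ?PE) (\<lambda>g. ({\<one>, g}, g)) s = reval (rm_of_im ?PE) (\<lambda>g. ({\<one>, g}, g)) t"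
      if "(s, t) \<in> FR_relations G" for s t
      using that
      by (auto simp: FR_relations_def rm_of_im_def prefix_expansion_simps(3)
          prefix_expansion_generators(2) intro: prefix_expansion_generators(3,4))
    then have "\<exists>\<theta> \<in> rm_hom (FR G) (rm_of_im ?PE). \<forall>g \<in> ?X. \<theta> (?c (RGen g)) = ({\<one>, g}, g)"
      unfolding FR_def
      by (intro presented_rm_lift PE.restriction_monoid_rm_of_im)
        (auto simp: rm_of_im_def prefix_expansion_generators(1))
    then show thesis using that by blast
  qed
  \<comment> \<open>As the image of a morphism, \<open>?I\<close> is closed under all operations of
    \<open>FR G\<close>. It contains the generators by \<open>psi_generator\<close>, so induction on
    terms shows that it contains every class.\<close>
  let ?I = "psi ` carrier ?PE"
  have psi: "psi x \<otimes>\<^bsub>FR G\<^esub> psi y \<in> ?I" "rstar (FR G) (psi x) \<in> ?I" "rplus (FR G) (psi x) \<in> ?I"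
    "\<one>\<^bsub>FR G\<^esub> \<in> ?I"
    if "x \<in> carrier ?PE" "y \<in> carrier ?PE" for x y
  proof -
    have "psi x \<otimes>\<^bsub>FR G\<^esub> psi y = psi (x \<otimes>\<^bsub>?PE\<^esub> y)" "\<one>\<^bsub>FR G\<^esub> = psi \<one>\<^bsub>?PE\<^esub>"
      "rstar (FR G) (psi x) = psi (im_inv ?PE x \<otimes>\<^bsub>?PE\<^esub> x)"
      "rplus (FR G) (psi x) = psi (x \<otimes>\<^bsub>?PE\<^esub> im_inv ?PE x)"
      using psi_hom that by (simp_all add: rm_hom_def hom_def rm_of_im_def)
    then show "psi x \<otimes>\<^bsub>FR G\<^esub> psi y \<in> ?I" "rstar (FR G) (psi x) \<in> ?I" "rplus (FR G) (psi x) \<in> ?I"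
      "\<one>\<^bsub>FR G\<^esub> \<in> ?I"
      using that PE.im_inv_props(1) by simp_all
  qed
  have "?c s \<in> ?I" if "s \<in> rterms ?X" for s
    using that
  proof (induction s)
    case (RGen g)
    then show ?case
      using psi_generator[of g] prefix_expansion_generators(1)[of g] by force
  next
    case ROne
    then show ?case using psi(4)[OF PE.one_closed PE.one_closed] by (simp add: simps)
  next
    case (RMul s t)
    then have "?c s \<in> ?I" "?c t \<in> ?I" by simp_all
    then have "?c s \<otimes>\<^bsub>FR G\<^esub> ?c t \<in> ?I" using psi(1) by auto
    then show ?case using RMul.prems by (simp add: simps)
  next
    case (RStar s)
    then have "?c s \<in> ?I" by simp
    then have "rstar (FR G) (?c s) \<in> ?I" using psi(2) by auto
    then show ?case using RStar.prems by (simp add: simps)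
  next
    case (RPlus s)
    then have "?c s \<in> ?I" by simp
    then have "rplus (FR G) (?c s) \<in> ?I" using psi(3) by auto
    then show ?case using RPlus.prems by (simp add: simps)
  qed
  then have "carrier (FR G) \<subseteq> ?I"
    unfolding simps by (blast elim: quotientE)
  with \<theta> show ?thesis by (rule rm_isomorphic_prefix_expansion)
qed

lemma (in group) FI_isomorphic_prefix_expansion:
  "rm_isomorphic (rm_of_im (prefix_expansion G)) (rm_of_im (FI G))"
proof -
  let ?PE = "prefix_expansion G"
  let ?X = "carrier G"
  let ?c = "\<lambda>s. it_cong_rel ?X (FI_relations G) `` {s}"
  note simps = presented_im_simps[where X = ?X and R = "FI_relations G", folded FI_def]
    im_inv_presented_im[where X = ?X and R = "FI_relations G", folded FI_def]
  interpret PE: inverse_monoid ?PE by (rule prefix_expansion_inverse)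
  interpret M: inverse_monoid "FI G"
    unfolding FI_def by (rule inverse_monoid_presented_im)
  interpret T: restriction_monoid "rm_of_im (FI G)"
    by (rule M.restriction_monoid_rm_of_im)
  have M: "carrier (rm_of_im (FI G)) = carrier (FI G)" "\<one>\<^bsub>rm_of_im (FI G)\<^esub> = \<one>\<^bsub>FI G\<^esub>"
    "x \<otimes>\<^bsub>rm_of_im (FI G)\<^esub> y = x \<otimes>\<^bsub>FI G\<^esub> y"
    "rstar (rm_of_im (FI G)) x = im_inv (FI G) x \<otimes>\<^bsub>FI G\<^esub> x"
    "rplus (rm_of_im (FI G)) x = x \<otimes>\<^bsub>FI G\<^esub> im_inv (FI G) x" for x y
    by (simp_all add: rm_of_im_def)
  have rel: "?c s = ?c t" if "(s, t) \<in> FI_relations G" "s \<in> iterms ?X" "t \<in> iterms ?X" for s t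
    using that by (simp add: it_cong_class_eq_iff it_cong.rel)
  \<comment> \<open>Under \<open>rm_of_im\<close> the plus and star of a class unfold to the classes
    of \<open>IPlus\<close> and \<open>IStar\<close>, so the locale laws again match the defining
    relations.\<close>
  interpret strong_premorphism G "rm_of_im (FI G)" "\<lambda>g. ?c (IGen g)"
  proof unfold_locales
    fix g h assume gh: "g \<in> ?X" "h \<in> ?X"
    then show "?c (IGen g) \<in> carrier (rm_of_im (FI G))" by (simp add: M simps quotientI)
    show "?c (IGen g) \<otimes>\<^bsub>rm_of_im (FI G)\<^esub> ?c (IGen h) =
        rplus (rm_of_im (FI G)) (?c (IGen g)) \<otimes>\<^bsub>rm_of_im (FI G)\<^esub> ?c (IGen (g \<otimes> h))"
      "?c (IGen g) \<otimes>\<^bsub>rm_of_im (FI G)\<^esub> ?c (IGen h) =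
        ?c (IGen (g \<otimes> h)) \<otimes>\<^bsub>rm_of_im (FI G)\<^esub> rstar (rm_of_im (FI G)) (?c (IGen h))"
      unfolding M using gh
      by (simp_all add: simps) (rule rel; auto simp: FI_relations_def)+
  next
    show "?c (IGen \<one>) = \<one>\<^bsub>rm_of_im (FI G)\<^esub>"
      unfolding M simps by (intro rel) (auto simp: FI_relations_def)
  qed
  obtain \<theta> where \<theta>: "\<theta> \<in> rm_hom (rm_of_im (FI G)) (rm_of_im ?PE)"
    "\<And>g. g \<in> ?X \<Longrightarrow> \<theta> (?c (IGen g)) = ({\<one>, g}, g)"
  proof -
    have "ieval ?PE (\<lambda>g. ({\<one>, g}, g)) s = ieval ?PE (\<lambda>g. ({\<one>, g}, g)) t"
      if "(s, t) \<in> FI_relations G" for s t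
      using that
      by (auto simp: FI_relations_def prefix_expansion_simps(3)
          prefix_expansion_generators(2) intro: prefix_expansion_generators(3,4))
    then have "\<exists>\<theta> \<in> rm_hom (rm_of_im (FI G)) (rm_of_im ?PE).
        \<forall>g \<in> ?X. \<theta> (?c (IGen g)) = ({\<one>, g}, g)"
      unfolding FI_def
      by (intro presented_im_lift PE.inverse_monoid_axioms)
        (auto simp: prefix_expansion_generators(1))
    then show thesis using that by blast
  qed
  let ?I = "psi ` carrier ?PE"
  have psi: "psi x \<otimes>\<^bsub>FI G\<^esub> psi y = psi (x \<otimes>\<^bsub>?PE\<^esub> y)" "psi x \<in> carrier (FI G)"
    "psi \<one>\<^bsub>?PE\<^esub> = \<one>\<^bsub>FI G\<^esub>"
    if "x \<in> carrier ?PE" "y \<in> carrier ?PE" for x y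
    using psi_hom that by (auto simp: rm_hom_def hom_def rm_of_im_def)
  \<comment> \<open>As a morphism of restriction monoids \<open>psi\<close> is only known to
    preserve star and plus. The \<open>IInv\<close> case of the induction needs the inverse itself,
    which is preserved by uniqueness of inverses.\<close>
  have psi_inv: "im_inv (FI G) (psi x) = psi (im_inv ?PE x)" if "x \<in> carrier ?PE" for x
    using that PE.im_inv_props[OF that] by (intro M.im_inv_eqI) (simp_all add: psi)
  have "?c s \<in> ?I" if "s \<in> iterms ?X" for s
    using that
  proof (induction s)
    case (IGen g)
    then show ?case
      using psi_generator[of g] prefix_expansion_generators(1)[of g] by force
  next
    case IOne
    then show ?case
      using psi(3)[OF PE.one_closed PE.one_closed] PE.one_closed by (metis imageI simps(2))
  next
    case (IMul s t)
    then have "?c s \<in> ?I" "?c t \<in> ?I" by simp_all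
    then have "?c s \<otimes>\<^bsub>FI G\<^esub> ?c t \<in> ?I" by (auto simp: psi)
    then show ?case using IMul.prems by (simp add: simps)
  next
    case (IInv s)
    then have "?c s \<in> ?I" by simp
    then have "im_inv (FI G) (?c s) \<in> ?I" by (auto simp: psi_inv PE.im_inv_props(1))
    then show ?case using IInv.prems by (simp add: simps)
  qed
  then have "carrier (rm_of_im (FI G)) \<subseteq> ?I"
    unfolding M simps by (blast elim: quotientE)
  with \<theta> show ?thesis by (rule rm_isomorphic_prefix_expansion)
qed

theorem corollary8p11:
  fixes G :: "('g, 'm) monoid_scheme"
  assumes "group G"
  shows "inverse_monoid (FR G)
    \<and> (\<forall>a \<in> carrier (FR G).
         rstar (FR G) a = im_inv (FR G) a \<otimes>\<^bsub>FR G\<^esub> a \<and>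
         rplus (FR G) a = a \<otimes>\<^bsub>FR G\<^esub> im_inv (FR G) a)
    \<and> rm_isomorphic (FR G) (rm_of_im (FI G))
    \<and> rm_isomorphic (FR G) (rm_of_im (prefix_expansion G))"
proof -
  interpret group G by fact
  note PE = prefix_expansion_inverse(1)
  have FR: "restriction_monoid (FR G)"
    unfolding FR_def by (rule restriction_monoid_presented_rm)
  note inverse = rm_isomorphic_inverse_monoid[OF PE FR FR_isomorphic_prefix_expansion]
  \<comment> \<open>Both isomorphisms constructed above start at the prefix expansion. The one onto
    \<open>FR G\<close> is reversed here and then composed with the one onto
    \<open>FI G\<close>.\<close>
  have "rm_isomorphic (FR G) (rm_of_im (prefix_expansion G))"
    by (rule rm_isomorphic_sym[OF _ FR_isomorphic_prefix_expansion])
      (rule inverse_monoid.restriction_monoid_rm_of_im[OF PE])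
  with rm_isomorphic_trans[OF this FI_isomorphic_prefix_expansion] inverse show ?thesis
    by blast
qed

end
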